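(* Extension Roman Hitting Function is para-NP-hard under each of the following parameterizations of an instance $(H,\tau,f)$: $|f^{-1}(0)|$, $|f^{-1}(1)|$, $|f^{-1}(2)|$, and $|f^{-1}(\{0,2\})|$.
   Context: A hypergraph is $H=(X,(s_i)_{i\in I})$ with finite $X$, finite index set $I$, $s_i\subseteq X$ (repetitions allowed). A correspondence is a map $\tau:X\to I$ with $x\in s_{\tau(x)}$ for all $x$. A function $g:X\to\{0,1,2\}$ is a Roman hitting function (rhf) if for every $i\in I$ there is $x\in s_i$ with $g(x)=2$ or there is $x$ with $\tau(x)=i$ and $g(x)=1$. Functions are ordered pointwise; an rhf $g$ is minimal if every rhf $h\le g$ equals $g$. Extension Roman Hitting Function: given $H$, $\tau$ and $f:X\to\{0,1,2\}$, decide whether there is a minimal rhf $g$ with $f\le g$. *)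

theory Defs
  imports Main "HOL-Library.FuncSet" "HOL-Computational_Algebra.Polynomial"
begin

section \<open>Turing machines\<close>

text \<open>
  Nondeterministic multi-tape machines. States and tape symbols are natural numbers; as the
  transition set is finite, only finitely many of them matter. State 0 is initial, state 1 is
  accepting. A transition (q, as, q', bs) applies in state q if as are the scanned symbols;
  bs lists, for each tape, the symbol to write and the head movement.
\<close>

datatype move = Go_Left | Stay | Go_Right

record tm =
  tapes :: nat
  trans :: "(nat \<times> nat list \<times> nat \<times> (nat \<times> move) list) set"

definition wf_tm :: "tm \<Rightarrow> bool" where
  "wf_tm M \<longleftrightarrow> tapes M \<ge> 1 \<and> finite (trans M) \<and>
     (\<forall>(q, as, q', bs) \<in> trans M. length as = tapes M \<and> length bs = tapes M)"

definition deterministic :: "tm \<Rightarrow> bool" where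
  "deterministic M \<longleftrightarrow>
     (\<forall>q as q1 bs1 q2 bs2. (q, as, q1, bs1) \<in> trans M \<longrightarrow> (q, as, q2, bs2) \<in> trans M \<longrightarrow>
        q1 = q2 \<and> bs1 = bs2)"

text \<open>A tape is infinite to the right only; it is given by its contents and the head position.\<close>

type_synonym tape = "(nat \<Rightarrow> nat) \<times> nat"

type_synonym config = "nat \<times> tape list"

definition scanned :: "tape \<Rightarrow> nat" where
  "scanned t = fst t (snd t)"

text \<open>In cell 0, a move to the left leaves the head where it is (truncated subtraction).\<close>

fun move_head :: "move \<Rightarrow> nat \<Rightarrow> nat" where
  "move_head Go_Left h = h - 1"
| "move_head Stay h = h"
| "move_head Go_Right h = h + 1"

definition act :: "nat \<times> move \<Rightarrow> tape \<Rightarrow> tape" where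
  "act b t = ((fst t)(snd t := fst b), move_head (snd b) (snd t))"

definition step :: "tm \<Rightarrow> config \<Rightarrow> config \<Rightarrow> bool" where
  "step M c c' \<longleftrightarrow>
     (\<exists>bs. (fst c, map scanned (snd c), fst c', bs) \<in> trans M \<and> snd c' = map2 act bs (snd c))"

definition halted :: "tm \<Rightarrow> config \<Rightarrow> bool" where
  "halted M c \<longleftrightarrow> (\<nexists>c'. step M c c')"

text \<open>
  Symbol 0 is the blank, symbol 1 the left-end marker, 2 and 3 are the bits. A string occupies
  the cells from 1 on.
\<close>

definition bit_symbol :: "bool \<Rightarrow> nat" where
  "bit_symbol b = (if b then 3 else 2)"

definition string_tape :: "bool list \<Rightarrow> tape" where
  "string_tape w =
     ((\<lambda>i. if i = 0 then 1 else if i \<le> length w then bit_symbol (w ! (i - 1)) else 0), 0)"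

text \<open>The input is on the first tape.\<close>

definition init_config :: "tm \<Rightarrow> bool list \<Rightarrow> config" where
  "init_config M w = (0, string_tape w # replicate (tapes M - 1) (string_tape []))"

text \<open>The output is on the last tape and extends up to the first blank.\<close>

definition has_output :: "config \<Rightarrow> bool list \<Rightarrow> bool" where
  "has_output c w \<longleftrightarrow>
     (\<forall>i < length w. fst (last (snd c)) (i + 1) = bit_symbol (w ! i)) \<and>
     fst (last (snd c)) (length w + 1) = 0"


section \<open>Polynomial time, NP, NP-hardness\<close>

definition polytime_computable :: "(bool list \<Rightarrow> bool list) \<Rightarrow> bool" where
  "polytime_computable F \<longleftrightarrow>
     (\<exists>M (p :: nat poly). wf_tm M \<and> deterministic M \<and>
        (\<forall>w. \<exists>t c. t \<le> poly p (length w) \<and> (step M ^^ t) (init_config M w) c \<and>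
                   halted M c \<and> has_output c (F w)))"

definition accepts :: "tm \<Rightarrow> bool list \<Rightarrow> bool" where
  "accepts M w \<longleftrightarrow> (\<exists>c. (step M)\<^sup>*\<^sup>* (init_config M w) c \<and> halted M c \<and> fst c = 1)"

text \<open>All runs on an input w have length at most p(|w|).\<close>

definition runs_in_time :: "tm \<Rightarrow> nat poly \<Rightarrow> bool" where
  "runs_in_time M p \<longleftrightarrow>
     (\<forall>w t c. (step M ^^ t) (init_config M w) c \<longrightarrow> t \<le> poly p (length w))"

definition NP :: "bool list set set" where
  "NP = {L. \<exists>M p. wf_tm M \<and> runs_in_time M p \<and> (\<forall>w. w \<in> L \<longleftrightarrow> accepts M w)}"

definition poly_reducible :: "bool list set \<Rightarrow> bool list set \<Rightarrow> bool" where
  "poly_reducible L L' \<longleftrightarrow> (\<exists>F. polytime_computable F \<and> (\<forall>w. w \<in> L \<longleftrightarrow> F w \<in> L'))"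

definition NP_hard :: "bool list set \<Rightarrow> bool" where
  "NP_hard L \<longleftrightarrow> (\<forall>L' \<in> NP. poly_reducible L' L)"

text \<open>
  A parameterized problem is given by an encoding of its instances, the set of its yes-instances
  and the parameter. It is para-NP-hard if it is NP-hard already for some constant value of the
  parameter, that is, if one of its slices is NP-hard.
\<close>

definition slice :: "('a \<Rightarrow> bool list) \<Rightarrow> 'a set \<Rightarrow> ('a \<Rightarrow> nat) \<Rightarrow> nat \<Rightarrow> bool list set" where
  "slice enc Yes \<kappa> k = enc ` {x \<in> Yes. \<kappa> x = k}"

definition para_NP_hard :: "('a \<Rightarrow> bool list) \<Rightarrow> 'a set \<Rightarrow> ('a \<Rightarrow> nat) \<Rightarrow> bool" where
  "para_NP_hard enc Yes \<kappa> \<longleftrightarrow> (\<exists>k. NP_hard (slice enc Yes \<kappa> k))"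


section \<open>Roman hitting functions\<close>

definition hypergraph :: "'x set \<Rightarrow> 'i set \<Rightarrow> ('i \<Rightarrow> 'x set) \<Rightarrow> bool" where
  "hypergraph X I s \<longleftrightarrow> finite X \<and> finite I \<and> (\<forall>i\<in>I. s i \<subseteq> X)"

definition correspondence ::
  "'x set \<Rightarrow> 'i set \<Rightarrow> ('i \<Rightarrow> 'x set) \<Rightarrow> ('x \<Rightarrow> 'i) \<Rightarrow> bool" where
  "correspondence X I s \<tau> \<longleftrightarrow> \<tau> \<in> X \<rightarrow> I \<and> (\<forall>x\<in>X. x \<in> s (\<tau> x))"

definition rhf ::
  "'x set \<Rightarrow> 'i set \<Rightarrow> ('i \<Rightarrow> 'x set) \<Rightarrow> ('x \<Rightarrow> 'i) \<Rightarrow> ('x \<Rightarrow> nat) \<Rightarrow> bool" where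
  "rhf X I s \<tau> g \<longleftrightarrow> g \<in> X \<rightarrow> {0, 1, 2} \<and>
     (\<forall>i\<in>I. (\<exists>x\<in>s i. g x = 2) \<or> (\<exists>x\<in>X. \<tau> x = i \<and> g x = 1))"

definition minimal_rhf ::
  "'x set \<Rightarrow> 'i set \<Rightarrow> ('i \<Rightarrow> 'x set) \<Rightarrow> ('x \<Rightarrow> 'i) \<Rightarrow> ('x \<Rightarrow> nat) \<Rightarrow> bool" where
  "minimal_rhf X I s \<tau> g \<longleftrightarrow> rhf X I s \<tau> g \<and>
     (\<forall>h. rhf X I s \<tau> h \<longrightarrow> (\<forall>x\<in>X. h x \<le> g x) \<longrightarrow> (\<forall>x\<in>X. h x = g x))"

definition extendable_to_minimal_rhf ::
  "'x set \<Rightarrow> 'i set \<Rightarrow> ('i \<Rightarrow> 'x set) \<Rightarrow> ('x \<Rightarrow> 'i) \<Rightarrow> ('x \<Rightarrow> nat) \<Rightarrow> bool" where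
  "extendable_to_minimal_rhf X I s \<tau> f \<longleftrightarrow> (\<exists>g. minimal_rhf X I s \<tau> g \<and> (\<forall>x\<in>X. f x \<le> g x))"


section \<open>The problem Extension Roman Hitting Function\<close>

text \<open>
  As input to a machine, an instance has the ground set {..<n} and the index set {..<m};
  the family of hyperedges and the functions are given by their lists of values.
\<close>

record erhf_instance =
  num_vertices :: nat
  edge_list :: "nat set list"
  tau_list :: "nat list"
  f_list :: "nat list"

abbreviation vertices :: "erhf_instance \<Rightarrow> nat set" where
  "vertices J \<equiv> {..<num_vertices J}"

abbreviation indices :: "erhf_instance \<Rightarrow> nat set" where
  "indices J \<equiv> {..<length (edge_list J)}"

abbreviation edge :: "erhf_instance \<Rightarrow> nat \<Rightarrow> nat set" where
  "edge J \<equiv> (!) (edge_list J)"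

abbreviation tau :: "erhf_instance \<Rightarrow> nat \<Rightarrow> nat" where
  "tau J \<equiv> (!) (tau_list J)"

abbreviation fval :: "erhf_instance \<Rightarrow> nat \<Rightarrow> nat" where
  "fval J \<equiv> (!) (f_list J)"

definition erhf_instances :: "erhf_instance set" where
  "erhf_instances = {J. length (tau_list J) = num_vertices J \<and> length (f_list J) = num_vertices J \<and>
     hypergraph (vertices J) (indices J) (edge J) \<and>
     correspondence (vertices J) (indices J) (edge J) (tau J) \<and>
     fval J \<in> vertices J \<rightarrow> {0, 1, 2}}"

definition ext_RHF :: "erhf_instance set" where
  "ext_RHF = {J \<in> erhf_instances.
     extendable_to_minimal_rhf (vertices J) (indices J) (edge J) (tau J) (fval J)}"

text \<open>The number of vertices v such that f(v) lies in A.\<close>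

definition preimage_size :: "nat set \<Rightarrow> erhf_instance \<Rightarrow> nat" where
  "preimage_size A J = card {v \<in> vertices J. fval J v \<in> A}"

text \<open>
  Numbers are written in unary, which is harmless as none exceeds the number of vertices, the
  number of hyperedges, or 2; the hypergraph is given by its incidence matrix.
\<close>

definition unary :: "nat \<Rightarrow> bool list" where
  "unary n = replicate n True @ [False]"

definition encode :: "erhf_instance \<Rightarrow> bool list" where
  "encode J =
     unary (num_vertices J) @ unary (length (edge_list J)) @
     concat (map (\<lambda>e. map (\<lambda>v. v \<in> e) [0..<num_vertices J]) (edge_list J)) @
     concat (map unary (tau_list J)) @
     concat (map unary (f_list J))"

lemma unary_append_eq_iff: "unary m @ u = unary n @ v \<longleftrightarrow> m = n \<and> u = v"
proof (induction m arbitrary: n)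
  case 0
  show ?case by (cases n) (auto simp: unary_def)
next
  case (Suc m)
  then show ?case by (cases n) (auto simp: unary_def)
qed

lemma concat_unary_append_eqD:
  assumes "length as = length bs" "concat (map unary as) @ u = concat (map unary bs) @ v"
  shows "as = bs \<and> u = v"
  using assms by (induction as bs rule: list_induct2) (auto simp: unary_append_eq_iff)

lemma incidence_append_eqD:
  assumes "length E = length F" "\<forall>e\<in>set E. e \<subseteq> {..<n}" "\<forall>e\<in>set F. e \<subseteq> {..<n}"
    and "concat (map (\<lambda>e. map (\<lambda>v. v \<in> e) [0..<n]) E) @ u =
         concat (map (\<lambda>e. map (\<lambda>v. v \<in> e) [0..<n]) F) @ w"
  shows "E = F \<and> u = w"
  using assms by (induction E F rule: list_induct2) (auto simp: subset_iff)

lemma inj_on_encode: "inj_on encode erhf_instances"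
proof (rule inj_onI)
  fix J K assume J: "J \<in> erhf_instances" and K: "K \<in> erhf_instances" and eq: "encode J = encode K"
  from eq have n: "num_vertices J = num_vertices K"
    and m: "length (edge_list J) = length (edge_list K)"
    and rest: "concat (map (\<lambda>e. map (\<lambda>v. v \<in> e) [0..<num_vertices J]) (edge_list J)) @
         concat (map unary (tau_list J)) @ concat (map unary (f_list J)) =
       concat (map (\<lambda>e. map (\<lambda>v. v \<in> e) [0..<num_vertices J]) (edge_list K)) @
         concat (map unary (tau_list K)) @ concat (map unary (f_list K))"
    unfolding encode_def by (auto simp: unary_append_eq_iff)
  have sub: "\<forall>e\<in>set (edge_list J). e \<subseteq> {..<num_vertices J}"
            "\<forall>e\<in>set (edge_list K). e \<subseteq> {..<num_vertices J}"
    using J K n by (auto simp: erhf_instances_def hypergraph_def in_set_conv_nth subset_iff)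
  have len: "length (tau_list J) = length (tau_list K)" "length (f_list J) = length (f_list K)"
    using J K n by (auto simp: erhf_instances_def)
  from incidence_append_eqD[OF m sub rest]
  have E: "edge_list J = edge_list K"
    and rest': "concat (map unary (tau_list J)) @ concat (map unary (f_list J)) =
       concat (map unary (tau_list K)) @ concat (map unary (f_list K))" by auto
  from concat_unary_append_eqD[OF len(1) rest']
  have T: "tau_list J = tau_list K"
    and rest'': "concat (map unary (f_list J)) @ [] = concat (map unary (f_list K)) @ []" by auto
  from concat_unary_append_eqD[OF len(2) rest''] have "f_list J = f_list K" by simp
  with n E T show "J = K" by simp
qed

end

theory Submission
  imports Defs
begin

text \<open>
  Once every halted accepting configuration has an idle transition, a machine with time bound p
  accepts w iff it has a run of some fixed length beyond p(|w|). Such a run is a tiling of a grid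
  whose row t shows the tapes at time t. Written row by row, the grid becomes a line of cells in
  which a tile constrains its successor and the tile N cells further on.

  In the instance, every vertex has a hyperedge of its own as its image under \<open>\<tau>\<close>, so a vertex of
  value 2 needs a private hyperedge other than that. Each cell has a vertex per tile and a hyperedge
  of the allowed tiles, which has no preimage under \<open>\<tau>\<close> and so must contain a vertex of value 2.
  For two conflicting tiles x and y there is a vertex u with \<open>s (\<tau> u) = {u, x}\<close> and two hyperedges
  {u, x} and {u, y}. If x and y both have value 2, then u cannot have value 1, because x lies in
  \<open>s (\<tau> u)\<close>, nor value 2, because it has no private hyperedge. So \<open>f u \<ge> 1\<close> forbids the conflict,
  which leaves room both for f = 1 everywhere and for f with values in {0, 2}.

  The incidence matrix of such an instance is so regular that a machine whose work tapes serve as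
  unary counters can print it with nested loops.
\<close>

text \<open>NP is given by machines, so every NP machine M is reduced directly, and the reduction
  must itself be a machine. M and its time bound fix tiles, conflicts and exponents; only the sizes
  and the allowed tiles of the first row depend on the input of length n. One number
  \<open>N = (n + 2) ^ e\<close> bounds both time and space, since a head moves at most one cell per
  step. Idling is needed because the instance cannot depend on the time at which M accepts. The line
  has \<open>N + Q\<close> cells that impose constraints, where \<open>Q = N * N\<close>, and then N
  cells that impose none, so that the tile N cells further on always exists. Constraints at
  \<open>N * N\<close> cells suffice to recover a run; the surplus is harmless, as an accepting run
  idles forever, and it spares a subtraction, since the first N cells are printed apart and Q
  further ones follow. All four parameters are 0 on the instances: f simply avoids the values that
  the parameter counts.\<close>

section \<open>Minimal Roman hitting functions\<close>

text \<open>The index \<open>\<tau> x\<close> is excluded because lowering x from 2 to 1 keeps that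
  edge hit. An edge i as described would be lost, so it witnesses that the value 2 is
  needed.\<close>

definition private_edge ::
  "'x set \<Rightarrow> ('i \<Rightarrow> 'x set) \<Rightarrow> ('x \<Rightarrow> 'i) \<Rightarrow> ('x \<Rightarrow> nat) \<Rightarrow> 'x \<Rightarrow> 'i \<Rightarrow> bool" where
  "private_edge X s \<tau> g x i \<longleftrightarrow> i \<noteq> \<tau> x \<and> x \<in> s i \<and> (\<forall>y\<in>s i. g y = 2 \<longrightarrow> y = x) \<and>
     (\<forall>y\<in>X. \<tau> y = i \<longrightarrow> g y \<noteq> 1)"

lemma rhf_values: "rhf X I s \<tau> g \<Longrightarrow> x \<in> X \<Longrightarrow> g x = 0 \<or> g x = 1 \<or> g x = 2"
  unfolding rhf_def by (auto dest: Pi_mem)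

text \<open>Otherwise \<open>g(x := 1)\<close> would still be an rhf: the edge
  \<open>\<tau> x\<close> is hit by the value 1, and every other edge is hit by some other
  vertex.\<close>

lemma minimal_rhf_two:
  assumes g: "minimal_rhf X I s \<tau> g" and x: "x \<in> X" "g x = 2"
  shows "\<exists>i\<in>I. private_edge X s \<tau> g x i"
proof (rule ccontr)
  assume no: "\<not> ?thesis"
  have r: "rhf X I s \<tau> g" using g by (simp add: minimal_rhf_def)
  have "rhf X I s \<tau> (g(x := 1))"
    unfolding rhf_def
  proof (intro conjI ballI)
    show "g(x := 1) \<in> X \<rightarrow> {0, 1, 2}" using rhf_values[OF r] by fastforce
    fix i assume i: "i \<in> I"
    have cov: "(\<exists>y\<in>s i. g y = 2) \<or> (\<exists>y\<in>X. \<tau> y = i \<and> g y = 1)"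
      using r i by (auto simp: rhf_def)
    show "(\<exists>y\<in>s i. (g(x := 1)) y = 2) \<or> (\<exists>y\<in>X. \<tau> y = i \<and> (g(x := 1)) y = 1)"
    proof (cases "i = \<tau> x")
      case True
      then show ?thesis using x by auto
    next
      case False
      have "\<not> private_edge X s \<tau> g x i" using no i by blast
      then show ?thesis using False cov x by (auto simp: private_edge_def)
    qed
  qed
  moreover have "\<forall>y\<in>X. (g(x := 1)) y \<le> g y" using x by simp
  ultimately have "\<forall>y\<in>X. (g(x := 1)) y = g y" using g unfolding minimal_rhf_def by blast
  then show False using x by (auto dest: bspec[of _ _ x])
qed

text \<open>The value 1 at x serves only the edge \<open>\<tau> x\<close>. If y of value 2 hit that
  edge as well, x could be lowered to 0.\<close>

lemma minimal_rhf_one: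
  assumes g: "minimal_rhf X I s \<tau> g" and x: "x \<in> X" "g x = 1" and y: "y \<in> s (\<tau> x)"
  shows "g y \<noteq> 2"
proof
  assume gy: "g y = 2"
  have r: "rhf X I s \<tau> g" using g by (simp add: minimal_rhf_def)
  have "rhf X I s \<tau> (g(x := 0))"
    unfolding rhf_def
  proof (intro conjI ballI)
    show "g(x := 0) \<in> X \<rightarrow> {0, 1, 2}" using rhf_values[OF r] by fastforce
    fix i assume i: "i \<in> I"
    have cov: "(\<exists>y\<in>s i. g y = 2) \<or> (\<exists>y\<in>X. \<tau> y = i \<and> g y = 1)"
      using r i by (auto simp: rhf_def)
    show "(\<exists>y\<in>s i. (g(x := 0)) y = 2) \<or> (\<exists>y\<in>X. \<tau> y = i \<and> (g(x := 0)) y = 1)"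
    proof (cases "i = \<tau> x")
      case True
      then show ?thesis using x y gy by (intro disjI1 bexI[of _ y]) auto
    next
      case False
      have "(g(x := 0)) y = 2" if "g y = 2" for y using that x by auto
      moreover have "(g(x := 0)) y = 1" if "\<tau> y = i" "g y = 1" for y using that False by auto
      ultimately show ?thesis using cov by blast
    qed
  qed
  moreover have "\<forall>y\<in>X. (g(x := 0)) y \<le> g y" using x by simp
  ultimately have "\<forall>y\<in>X. (g(x := 0)) y = g y" using g unfolding minimal_rhf_def by blast
  then show False using x by (auto dest: bspec[of _ _ x])
qed

text \<open>A smaller h loses the edge that needs x: \<open>\<tau> x\<close> if
  \<open>g x = 1\<close>, and the private edge if \<open>g x = 2\<close>. By
  \<open>one_unique\<close>, no two vertices of value 1 serve the same edge, where one of them could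
  be dropped.\<close>

lemma minimal_rhfI:
  assumes H: "hypergraph X I s" "correspondence X I s \<tau>"
    and r: "rhf X I s \<tau> g"
    and two: "\<And>x. x \<in> X \<Longrightarrow> g x = 2 \<Longrightarrow> \<exists>i\<in>I. private_edge X s \<tau> g x i"
    and one: "\<And>x y. x \<in> X \<Longrightarrow> g x = 1 \<Longrightarrow> y \<in> s (\<tau> x) \<Longrightarrow> g y \<noteq> 2"
    and one_unique: "\<And>x y. x \<in> X \<Longrightarrow> g x = 1 \<Longrightarrow> y \<in> X \<Longrightarrow> g y = 1 \<Longrightarrow> \<tau> x = \<tau> y \<Longrightarrow> x = y"
  shows "minimal_rhf X I s \<tau> g"
  unfolding minimal_rhf_def
proof (intro conjI allI impI ballI r)
  fix h x assume h: "rhf X I s \<tau> h" and le: "\<forall>x\<in>X. h x \<le> g x" and x: "x \<in> X"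
  have gr: "g y \<in> {0, 1, 2}" if "y \<in> X" for y using rhf_values[OF r that] by simp
  have hr: "h y \<in> {0, 1, 2}" if "y \<in> X" for y using rhf_values[OF h that] by simp
  have sub: "s i \<subseteq> X" if "i \<in> I" for i using H that by (auto simp: hypergraph_def)
  have h2: "g y = 2" if "y \<in> X" "h y = 2" for y
    using bspec[OF le that(1)] gr[OF that(1)] that(2) by auto
  show "h x = g x"
  proof (rule ccontr)
    assume "h x \<noteq> g x"
    with le x have lt: "h x < g x" by (meson le_neq_implies_less)
    consider "g x = 1" | "g x = 2" using gr[OF x] lt by auto
    then show False
    proof cases
      case 1
      then have hx: "h x = 0" using lt by simp
      have i: "\<tau> x \<in> I" using H x by (auto simp: correspondence_def)
      from h i consider y where "y \<in> s (\<tau> x)" "h y = 2" | y where "y \<in> X" "\<tau> y = \<tau> x" "h y = 1"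
        unfolding rhf_def by blast
      then show False
      proof cases
        fix y assume y: "y \<in> s (\<tau> x)" "h y = 2"
        then show False using one[OF x 1] h2 sub[OF i] by blast
      next
        fix y assume y: "y \<in> X" "\<tau> y = \<tau> x" "h y = 1"
        have "g y \<noteq> 2" using one[OF x 1] y H by (metis correspondence_def)
        moreover have "g y \<ge> 1" using y le by auto
        ultimately have "g y = 1" using gr[OF y(1)] by auto
        then have "y = x" using one_unique[OF x 1 y(1)] y by auto
        then show False using y hx by simp
      qed
    next
      case 2
      then obtain i where i: "i \<in> I" and p: "private_edge X s \<tau> g x i" using two x by blast
      from h i consider y where "y \<in> s i" "h y = 2" | y where "y \<in> X" "\<tau> y = i" "h y = 1"
        unfolding rhf_def by blast
      then show False
      proof cases
        fix y assume y: "y \<in> s i" "h y = 2"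
        then have "g y = 2" using h2 sub[OF i] by blast
        then have "y = x" using p y by (auto simp: private_edge_def)
        then show False using y lt 2 by simp
      next
        fix y assume y: "y \<in> X" "\<tau> y = i" "h y = 1"
        have "g y \<ge> 1" using y le by auto
        moreover have "g y \<noteq> 1" using p y by (auto simp: private_edge_def)
        ultimately have g2: "g y = 2" using gr[OF y(1)] by auto
        \<comment> \<open>As y lies in its own edge i, privacy forces \<open>y = x\<close>, whereas
          i differs from \<open>\<tau> x\<close>.\<close>
        have "y \<in> s i" using y H by (auto simp: correspondence_def)
        then have "y = x" using p g2 by (auto simp: private_edge_def)
        then show False using y p by (auto simp: private_edge_def)
      qed
    qed
  qed
qed

section \<open>Linear tilings as extension problems\<close>

text \<open>
  A tiling of the cells c < M + N by tiles s < K must avoid every conflict (a, up, b) at every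
  cell c < M, that is, tile a at c together with tile b at c + N (if up) or at c + 1 (otherwise);
  al c are the tiles allowed at c. Each cell carries one vertex per tile and one per conflict.
  A template of a hyperedge at cell c gives its vertices at the cells c, c + 1, and c + N.
\<close>

type_synonym conflict = "nat \<times> bool \<times> nat"

type_synonym template = "nat set \<times> nat set \<times> nat set"

definition slots :: "nat \<Rightarrow> conflict list \<Rightarrow> nat" where
  "slots K Cs = K + length Cs"

definition templates :: "nat \<Rightarrow> conflict list \<Rightarrow> nat set \<Rightarrow> template list" where
  "templates K Cs A =
     map (\<lambda>s. ({s}, {}, {})) [0..<K] @
     map (\<lambda>j. ({K + j, fst (Cs ! j)}, {}, {})) [0..<length Cs] @
     map (\<lambda>j. ({K + j, fst (Cs ! j)}, {}, {})) [0..<length Cs] @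
     map (\<lambda>j. case Cs ! j of (a, up, b) \<Rightarrow>
       ({K + j}, if up then {} else {b}, if up then {b} else {})) [0..<length Cs] @
     [(A, {}, {})]"

definition edge_slots :: "nat \<Rightarrow> conflict list \<Rightarrow> nat" where
  "edge_slots K Cs = slots K Cs + 2 * length Cs + 1"

lemma length_templates [simp]: "length (templates K Cs A) = edge_slots K Cs"
  by (simp add: templates_def edge_slots_def slots_def)

text \<open>For \<open>c < M\<close> the cells \<open>c + 1\<close> and \<open>c + N\<close> exist.
  The last N cells keep all their edges, so that every cell has equally many, but there {u, y}
  shrinks to {u} and forbids nothing.\<close>

definition cell_edge :: "nat \<Rightarrow> nat \<Rightarrow> nat \<Rightarrow> nat \<Rightarrow> template \<Rightarrow> nat set" where
  "cell_edge W M N c S = {v. v div W = c \<and> v mod W \<in> fst S \<or>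
     c < M \<and> (v div W = c + 1 \<and> v mod W \<in> fst (snd S) \<or> v div W = c + N \<and> v mod W \<in> snd (snd S))}"

definition tiling_instance ::
  "nat \<Rightarrow> conflict list \<Rightarrow> (nat \<Rightarrow> nat set) \<Rightarrow> (nat \<Rightarrow> nat) \<Rightarrow> nat \<Rightarrow> nat \<Rightarrow> erhf_instance" where
  "tiling_instance K Cs al fs M N =
     (let W = slots K Cs; V = edge_slots K Cs in
      \<lparr>num_vertices = (M + N) * W,
       edge_list = map (\<lambda>i. cell_edge W M N (i div V) (templates K Cs (al (i div V)) ! (i mod V)))
         [0..<(M + N) * V],
       tau_list = map (\<lambda>v. v div W * V + v mod W) [0..<(M + N) * W],
       f_list = map (\<lambda>v. fs (v mod W)) [0..<(M + N) * W]\<rparr>)"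

text \<open>Extensions of f have to be at least 1 on conflict vertices, and the g built from a
  tiling is at least 1 on tiles and 2 on conflict vertices. This is what \<open>fs_tile\<close> and
  \<open>fs_conflict\<close> provide for.\<close>

locale tiling =
  fixes K :: nat and Cs :: "conflict list" and al :: "nat \<Rightarrow> nat set" and fs :: "nat \<Rightarrow> nat"
    and M N :: nat
  assumes K_pos: "0 < K" and N_pos: "0 < N"
    and Cs_less: "\<And>j. j < length Cs \<Longrightarrow> fst (Cs ! j) < K \<and> snd (snd (Cs ! j)) < K"
    and al_less: "\<And>c. al c \<subseteq> {..<K}"
    and fs_tile: "\<And>s. s < K \<Longrightarrow> fs s \<le> 1"
    and fs_conflict: "\<And>s. K \<le> s \<Longrightarrow> fs s = 1 \<or> fs s = 2"
begin

abbreviation "W \<equiv> slots K Cs"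
abbreviation "V \<equiv> edge_slots K Cs"
abbreviation "L \<equiv> M + N"
abbreviation "J \<equiv> tiling_instance K Cs al fs M N"
abbreviation "T c \<equiv> templates K Cs (al c)"
abbreviation "cell_slot \<equiv> W + 2 * length Cs"

section \<open>Vertices and edges by cell and slot\<close>

lemma W_pos: "0 < W" and K_le_W: "K \<le> W" and W_less_V: "W < V" and V_pos: "0 < V"
  using K_pos by (auto simp: slots_def edge_slots_def)

lemma T_tile: "s < K \<Longrightarrow> T c ! s = ({s}, {}, {})"
  by (simp add: templates_def nth_append)

lemma T_conflict: "j < length Cs \<Longrightarrow> T c ! (K + j) = ({K + j, fst (Cs ! j)}, {}, {})"
  by (simp add: templates_def nth_append)

lemma T_first: "j < length Cs \<Longrightarrow> T c ! (W + j) = ({K + j, fst (Cs ! j)}, {}, {})"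
  by (simp add: templates_def nth_append slots_def)

lemma T_second: "j < length Cs \<Longrightarrow> Cs ! j = (a, up, b) \<Longrightarrow> T c ! (W + length Cs + j) =
    ({K + j}, if up then {} else {b}, if up then {b} else {})"
  by (simp add: templates_def nth_append slots_def)

lemma T_cell: "T c ! cell_slot = (al c, {}, {})"
  by (simp add: templates_def nth_append slots_def)

lemma cell_slot_less: "cell_slot < V" by (simp add: edge_slots_def)

lemma edge_slot_cases:
  assumes "k < V"
  obtains (tile) "k < K" | (conflict) j where "j < length Cs" "k = K + j"
    | (first) j where "j < length Cs" "k = W + j"
    | (second) j where "j < length Cs" "k = W + length Cs + j" | (cell) "k = cell_slot"
proof -
  consider "k < K" | "K \<le> k" "k < W" | "W \<le> k" "k < W + length Cs"
    | "W + length Cs \<le> k" "k < cell_slot" | "k = cell_slot"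
    using assms unfolding edge_slots_def by linarith
  then show thesis
  proof cases
    case 2 then show thesis using conflict[of "k - K"] by (simp add: slots_def)
  next
    case 3 then show thesis using first[of "k - W"] by simp
  next
    case 4 then show thesis using second[of "k - (W + length Cs)"] by simp
  qed (use tile cell in auto)
qed

lemma index_less:
  assumes "c < L" "s < n"
  shows "c * n + s < L * n"
proof -
  have "c * n + s < Suc c * n" using assms by simp
  also have "\<dots> \<le> L * n" using assms by (intro mult_le_mono1) simp
  finally show ?thesis .
qed

lemma div_less: "v < L * n \<Longrightarrow> v div n < L" for n
  by (simp add: less_mult_imp_div_less)

lemma edge_J: "c < L \<Longrightarrow> k < V \<Longrightarrow> edge J (c * V + k) = cell_edge W M N c (T c ! k)"
  using index_less[of c k V] by (simp add: tiling_instance_def Let_def)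

lemma tau_J: "c < L \<Longrightarrow> s < W \<Longrightarrow> tau J (c * W + s) = c * V + s"
  using index_less[of c s W] by (simp add: tiling_instance_def Let_def)

lemma f_J: "c < L \<Longrightarrow> s < W \<Longrightarrow> fval J (c * W + s) = fs s"
  using index_less[of c s W] by (simp add: tiling_instance_def Let_def)

lemma num_J [simp]: "num_vertices J = L * W" and length_J [simp]: "length (edge_list J) = L * V"
    "length (tau_list J) = L * W" "length (f_list J) = L * W"
  by (simp_all add: tiling_instance_def Let_def)

lemma vertex_cases:
  assumes "v \<in> vertices J"
  obtains c s where "c < L" "s < W" "v = c * W + s"
  using that[of "v div W" "v mod W"] assms W_pos div_less[of v W] by (simp add: div_mult_mod_eq)

lemma index_cases:
  assumes "i \<in> indices J"
  obtains c k where "c < L" "k < V" "i = c * V + k"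
  using that[of "i div V" "i mod V"] assms V_pos div_less[of i V] by (simp add: div_mult_mod_eq)

lemma mem_cell_edge: "s < W \<Longrightarrow> d * W + s \<in> cell_edge W M N c S \<longleftrightarrow>
    d = c \<and> s \<in> fst S \<or> c < M \<and> (d = c + 1 \<and> s \<in> fst (snd S) \<or> d = c + N \<and> s \<in> snd (snd S))"
  by (simp add: cell_edge_def)

lemma eq_index:
  fixes n :: nat
  assumes "s < n" "s' < n"
  shows "c * n + s = c' * n + s' \<longleftrightarrow> c = c' \<and> s = s'"
proof
  assume eq: "c * n + s = c' * n + s'"
  have "(c * n + s) div n = c" "(c * n + s) mod n = s" "(c' * n + s') div n = c'" "(c' * n + s') mod n = s'"
    using assms by simp_all
  then show "c = c' \<and> s = s'" using eq by simp
qed simp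

lemma hypergraph_J: "hypergraph (vertices J) (indices J) (edge J)"
  unfolding hypergraph_def
proof (intro conjI ballI)
  fix i assume "i \<in> indices J"
  then obtain c k where i: "c < L" "k < V" "i = c * V + k" by (rule index_cases)
  show "edge J i \<subseteq> vertices J"
  proof
    fix v assume "v \<in> edge J i"
    then have "v div W = c \<or> c < M \<and> (v div W = c + 1 \<or> v div W = c + N)"
      using i by (auto simp: edge_J cell_edge_def)
    then have "v div W < L" using i N_pos by auto
    then show "v \<in> vertices J"
      using W_pos by (simp add: div_less_iff_less_mult)
  qed
qed auto

lemma correspondence_J: "correspondence (vertices J) (indices J) (edge J) (tau J)"
  unfolding correspondence_def
proof (intro conjI ballI funcsetI)
  fix v assume "v \<in> vertices J"
  then obtain c s where v: "c < L" "s < W" "v = c * W + s" by (rule vertex_cases)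
  have sV: "s < V" using v W_less_V by simp
  show "tau J v \<in> indices J" using v index_less[OF v(1) sV] by (simp add: tau_J)
  have "s \<in> fst (T c ! s)"
    using sV
  proof (cases s rule: edge_slot_cases)
    case tile then show ?thesis by (simp add: T_tile)
  next
    case conflict then show ?thesis by (simp add: T_conflict)
  qed (use v in simp_all)
  then show "v \<in> edge J (tau J v)" using v sV by (simp add: tau_J edge_J mem_cell_edge)
qed

lemma J_instance: "J \<in> erhf_instances"
proof -
  have "fval J v \<in> {0, 1, 2}" if "v \<in> vertices J" for v
  proof -
    from that obtain c s where v: "c < L" "s < W" "v = c * W + s" by (rule vertex_cases)
    then show ?thesis using fs_tile[of s] fs_conflict[of s] by (cases "s < K") (auto simp: f_J)
  qed
  then show ?thesis
    using hypergraph_J correspondence_J unfolding erhf_instances_def by auto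
qed

section \<open>Valid tilings correspond to extensions\<close>

definition valid_tiling :: "(nat \<Rightarrow> nat) \<Rightarrow> bool" where
  "valid_tiling \<sigma> \<longleftrightarrow> (\<forall>c<L. \<sigma> c \<in> al c) \<and>
     (\<forall>c<M. \<forall>j<length Cs. case Cs ! j of (a, up, b) \<Rightarrow> \<not> (\<sigma> c = a \<and> \<sigma> (c + (if up then N else 1)) = b))"

text \<open>Each cell has an allowed tile of value 2. If there are several, any choice will do,
  because a conflict vertex excludes the value 2 on both tiles of its conflict, whichever others
  have it.\<close>

lemma tiling_of_extension:
  assumes "extendable_to_minimal_rhf (vertices J) (indices J) (edge J) (tau J) (fval J)"
  shows "\<exists>\<sigma>. valid_tiling \<sigma>"
proof -
  obtain g where g: "minimal_rhf (vertices J) (indices J) (edge J) (tau J) g"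
    and fg: "\<forall>v\<in>vertices J. fval J v \<le> g v"
    using assms unfolding extendable_to_minimal_rhf_def by blast
  note two = minimal_rhf_two[OF g]
  note one = minimal_rhf_one[OF g]
  have r: "rhf (vertices J) (indices J) (edge J) (tau J) g" using g by (simp add: minimal_rhf_def)
  have ex: "\<exists>s\<in>al c. g (c * W + s) = 2" if c: "c < L" for c
  proof -
    let ?i = "c * V + cell_slot"
    have i: "?i \<in> indices J" using index_less[OF c cell_slot_less] by simp
    \<comment> \<open>\<open>\<tau>\<close> only uses slots below W, so the edge of the cell cannot
      be hit by a value 1.\<close>
    have "tau J v \<noteq> ?i" if v: "v \<in> vertices J" for v
    proof -
      from v obtain d s where v: "d < L" "s < W" "v = d * W + s" by (rule vertex_cases)
      then show ?thesis using W_less_V eq_index[of s V cell_slot d c] cell_slot_less by (simp add: tau_J)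
    qed
    then obtain v where v: "v \<in> edge J ?i" "g v = 2" using r i unfolding rhf_def by blast
    then have "v \<in> vertices J" using hypergraph_J i unfolding hypergraph_def by blast
    then obtain d s where ds: "d < L" "s < W" "v = d * W + s" by (rule vertex_cases)
    then show ?thesis using v c by (auto simp: edge_J cell_slot_less T_cell mem_cell_edge)
  qed
  define \<sigma> where "\<sigma> c = (SOME s. s \<in> al c \<and> g (c * W + s) = 2)" for c
  have \<sigma>: "\<sigma> c \<in> al c \<and> g (c * W + \<sigma> c) = 2" if "c < L" for c
    unfolding \<sigma>_def by (rule someI_ex) (use ex[OF that] in blast)
  have "\<not> (\<sigma> c = a \<and> \<sigma> (c + (if up then N else 1)) = b)"
    if c: "c < M" and j: "j < length Cs" and C: "Cs ! j = (a, up, b)" for c j a up b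
  proof (rule notI, elim conjE)
    let ?d = "c + (if up then N else 1)" and ?u = "c * W + (K + j)"
    assume a: "\<sigma> c = a" and b: "\<sigma> ?d = b"
    have cL: "c < L" "?d < L" using c N_pos by auto
    have ab: "a < K" "b < K" using Cs_less[OF j] C by auto
    have g2: "g (c * W + a) = 2" "g (?d * W + b) = 2" using \<sigma> cL a b by blast+
    have s: "K + j < W" using j by (simp add: slots_def)
    have u: "?u \<in> vertices J" using index_less[OF cL(1) s] by simp
    have tu: "tau J ?u = c * V + (K + j)" using tau_J[OF cL(1) s] .
    have "g ?u \<ge> 1" using bspec[OF fg u] f_J[OF cL(1) s] fs_conflict[of "K + j"] by auto
    moreover have "g ?u \<noteq> 1"
    proof
      assume "g ?u = 1"
      moreover have "c * W + a \<in> edge J (tau J ?u)"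
        unfolding tu using ab K_le_W W_less_V s cL by (simp add: edge_J mem_cell_edge T_conflict j C)
      ultimately show False using one[OF u] g2 by blast
    qed
    ultimately have "g ?u = 2" using rhf_values[OF r u] by auto
    then obtain i where i: "i \<in> indices J" and p: "private_edge (vertices J) (edge J) (tau J) g ?u i"
      using two[OF u] by blast
    from i obtain c' k where c': "c' < L" and k: "k < V" and ik: "i = c' * V + k" by (rule index_cases)
    have e: "edge J i = cell_edge W M N c' (T c' ! k)" using c' k ik by (simp add: edge_J)
    have others: "v = ?u" if "v \<in> edge J i" "g v = 2" for v using p that by (auto simp: private_edge_def)
    have mem: "?u \<in> edge J i" and neq: "i \<noteq> tau J ?u" using p by (auto simp: private_edge_def)
    have ca: "c * W + a \<noteq> ?u" "?d * W + b \<noteq> ?u" using ab s eq_index[of _ W "K + j" _ c] K_le_W by auto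
    \<comment> \<open>Besides \<open>\<tau> u\<close>, the only edges containing u are the second
      copy and the edge to the other tile. Either contains a tile of value 2, so neither is private
      to u.\<close>
    from k show False
    proof (cases k rule: edge_slot_cases)
      case tile
      then show False using mem s by (simp add: e mem_cell_edge T_tile)
    next
      case (conflict j')
      then have "c' = c \<and> j' = j"
        using mem s Cs_less[of j'] by (auto simp: e mem_cell_edge T_conflict)
      then show False using neq ik conflict tu by simp
    next
      case (first j')
      then have "c' = c \<and> j' = j"
        using mem s Cs_less[of j'] by (auto simp: e mem_cell_edge T_first)
      then have "c * W + a \<in> edge J i"
        using ab K_le_W first by (simp add: e mem_cell_edge T_first C)
      then show False using others g2 ca by blast
    next
      case (second j')
      obtain a' up' b' where C': "Cs ! j' = (a', up', b')" by (cases "Cs ! j'") auto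
      have "c' = c \<and> j' = j"
        using mem s Cs_less[OF second(1)] second C' by (auto simp: e mem_cell_edge T_second split: if_splits)
      then have "?d * W + b \<in> edge J i"
        using ab K_le_W second c C by (auto simp: e mem_cell_edge T_second)
      then show False using others g2 ca by blast
    next
      case cell
      then show False using mem s al_less[of c'] by (auto simp: e mem_cell_edge T_cell)
    qed
  qed
  then have "valid_tiling \<sigma>" using \<sigma> unfolding valid_tiling_def by fastforce
  then show ?thesis by blast
qed

text \<open>Chosen tiles and all conflict vertices get 2, the other tiles 1. A chosen tile is
  private in the edge of its cell. A conflict vertex u for x and y is private in the second copy of
  {u, x} if x is not chosen, and otherwise in {u, y}, as the tiling then excludes y.\<close>

lemma extension_of_tiling:
  assumes t: "valid_tiling \<sigma>"
  shows "extendable_to_minimal_rhf (vertices J) (indices J) (edge J) (tau J) (fval J)"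
proof -
  have \<sigma>: "\<sigma> c \<in> al c" if "c < L" for c using t that by (auto simp: valid_tiling_def)
  have \<sigma>K: "\<sigma> c < K" if "c < L" for c using \<sigma>[OF that] al_less by blast
  have conf: "\<not> (\<sigma> c = a \<and> \<sigma> (c + (if up then N else 1)) = b)"
    if "c < M" "j < length Cs" "Cs ! j = (a, up, b)" for c j a up b
    using t that unfolding valid_tiling_def by fastforce
  define g :: "nat \<Rightarrow> nat" where
    "g v = (if v mod W = \<sigma> (v div W) \<or> K \<le> v mod W then 2 else 1)" for v
  have g: "g (c * W + s) = (if s = \<sigma> c \<or> K \<le> s then 2 else 1)" if "s < W" for c s
    using that by (simp add: g_def)
  have slotV: "s < W \<Longrightarrow> s < V" for s using W_less_V by simp
  have rhf: "rhf (vertices J) (indices J) (edge J) (tau J) g"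
    unfolding rhf_def
  proof (intro conjI ballI)
    show "g \<in> vertices J \<rightarrow> {0, 1, 2}" by (auto simp: g_def)
    fix i assume "i \<in> indices J"
    then obtain c k where c: "c < L" and k: "k < V" and ik: "i = c * V + k" by (rule index_cases)
    have e: "edge J i = cell_edge W M N c (T c ! k)" using c k ik by (simp add: edge_J)
    \<comment> \<open>\<open>g\<close> is nowhere 0, so each vertex hits its own edge: through
      \<open>\<tau>\<close> with value 1, through membership with value 2.\<close>
    have own: "(\<exists>x\<in>edge J i. g x = 2) \<or> (\<exists>x\<in>vertices J. tau J x = i \<and> g x = 1)" if "k < W"
    proof -
      let ?v = "c * W + k"
      have v: "?v \<in> vertices J" using index_less[OF c that] by simp
      moreover have "tau J ?v = i" using tau_J[OF c that] ik by simp
      moreover have "?v \<in> edge J i"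
        using v correspondence_J \<open>tau J ?v = i\<close> by (auto simp: correspondence_def)
      moreover have "g ?v = 2 \<or> g ?v = 1" by (simp add: g_def)
      ultimately show ?thesis by blast
    qed
    from k show "(\<exists>x\<in>edge J i. g x = 2) \<or> (\<exists>x\<in>vertices J. tau J x = i \<and> g x = 1)"
    proof (cases k rule: edge_slot_cases)
      case tile
      then show ?thesis using own K_le_W by simp
    next
      case conflict
      then show ?thesis using own by (simp add: slots_def)
    next
      case (first j)
      have s: "K + j < W" using first by (simp add: slots_def)
      show ?thesis
        using first s by (intro disjI1 bexI[of _ "c * W + (K + j)"]) (auto simp: e mem_cell_edge g T_first)
    next
      case (second j)
      obtain a' up' b' where C': "Cs ! j = (a', up', b')" by (cases "Cs ! j") auto
      have s: "K + j < W" using second by (simp add: slots_def)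
      show ?thesis
        using second s by (intro disjI1 bexI[of _ "c * W + (K + j)"]) (auto simp: e mem_cell_edge g T_second[OF _ C'])
    next
      case cell
      have "\<sigma> c < W" using \<sigma>K[OF c] K_le_W by simp
      then show ?thesis
        using \<sigma>[OF c] cell by (intro disjI1 bexI[of _ "c * W + \<sigma> c"]) (auto simp: e mem_cell_edge g T_cell)
    qed
  qed
  \<comment> \<open>Edges from slot W on have no preimage under \<open>\<tau>\<close>, so no value 1
    can spoil their privacy.\<close>
  have tau_ne: "tau J y \<noteq> c * V + k" if "W \<le> k" "k < V" "y \<in> vertices J" for y c k
  proof -
    from that(3) obtain d s where v: "d < L" "s < W" "y = d * W + s" by (rule vertex_cases)
    then show ?thesis using slotV[of s] eq_index[of s V k d c] that by (simp add: tau_J)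
  qed
  have "minimal_rhf (vertices J) (indices J) (edge J) (tau J) g"
  proof (rule minimal_rhfI[OF hypergraph_J correspondence_J rhf])
    fix v assume vJ: "v \<in> vertices J" and g2: "g v = 2"
    from vJ obtain c s where c: "c < L" and s: "s < W" and v: "v = c * W + s" by (rule vertex_cases)
    have priv: "\<exists>i\<in>indices J. private_edge (vertices J) (edge J) (tau J) g v i"
      if k: "W \<le> k" "k < V" and sk: "s \<in> fst (T c ! k)"
        and only: "\<And>d t. d < L \<Longrightarrow> t < W \<Longrightarrow> d * W + t \<in> cell_edge W M N c (T c ! k) \<Longrightarrow>
          t = \<sigma> d \<or> K \<le> t \<Longrightarrow> d = c \<and> t = s" for k
    proof (rule bexI[of _ "c * V + k"])
      show i: "c * V + k \<in> indices J" using index_less[OF c k(2)] by simp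
      have e: "edge J (c * V + k) = cell_edge W M N c (T c ! k)" using c k by (simp add: edge_J)
      show "private_edge (vertices J) (edge J) (tau J) g v (c * V + k)"
        unfolding private_edge_def
      proof (intro conjI ballI impI)
        show "c * V + k \<noteq> tau J v" using tau_ne[OF k vJ, of c] by simp
        show "v \<in> edge J (c * V + k)" using sk s by (simp add: e v mem_cell_edge)
        fix y assume y: "y \<in> edge J (c * V + k)" "g y = 2"
        then have "y \<in> vertices J" using hypergraph_J i unfolding hypergraph_def by blast
        then obtain d t where d: "d < L" "t < W" "y = d * W + t" by (rule vertex_cases)
        then show "y = v" using only[of d t] y by (auto simp: e g v split: if_splits)
      next
        fix y assume "y \<in> vertices J" "tau J y = c * V + k"
        then show "g y \<noteq> 1" using tau_ne k by blast
      qed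
    qed
    show "\<exists>i\<in>indices J. private_edge (vertices J) (edge J) (tau J) g v i"
    proof (cases "s < K")
      case True
      then have "s = \<sigma> c" using g2 s by (auto simp: v g split: if_splits)
      then show ?thesis
        using \<sigma>[OF c] al_less[of c] by (intro priv[of cell_slot]) (auto simp: edge_slots_def T_cell mem_cell_edge)
    next
      case False
      define j where "j = s - K"
      have j: "j < length Cs" "s = K + j" using False s by (auto simp: j_def slots_def)
      obtain a up b where C: "Cs ! j = (a, up, b)" by (cases "Cs ! j") auto
      have ab: "a < K" "b < K" using Cs_less[OF j(1)] C by auto
      show ?thesis
      proof (cases "\<sigma> c = a")
        case False
        show ?thesis
          by (rule priv[of "W + j"]) (use j C False ab in \<open>auto simp: edge_slots_def T_first mem_cell_edge\<close>)
      next
        case True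
        \<comment> \<open>For \<open>c \<ge> M\<close> nothing is known about tile b further on, but
          then the edge is {u} alone.\<close>
        then have nb: "\<sigma> (c + (if up then N else 1)) \<noteq> b" if "c < M" using conf[OF that j(1) C] by blast
        show ?thesis
          by (rule priv[of "W + length Cs + j"])
            (use j nb ab in \<open>auto simp: edge_slots_def T_second[OF _ C] mem_cell_edge split: if_splits\<close>)
      qed
    qed
  next
    fix v y assume vJ: "v \<in> vertices J" and g1: "g v = 1" and y: "y \<in> edge J (tau J v)"
    from vJ obtain c s where c: "c < L" and s: "s < W" and v: "v = c * W + s" by (rule vertex_cases)
    have sK: "s < K" "s \<noteq> \<sigma> c" using g1 s by (auto simp: v g split: if_splits)
    have "y \<in> cell_edge W M N c (T c ! s)" using y c s slotV by (simp add: v tau_J edge_J)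
    then have "y div W = c \<and> y mod W = s" using sK by (simp add: T_tile cell_edge_def)
    then show "g y \<noteq> 2" using sK by (simp add: g_def)
  next
    fix v y assume v: "v \<in> vertices J" and y: "y \<in> vertices J" and "tau J v = tau J y"
    from v obtain c s where "c < L" "s < W" "v = c * W + s" by (rule vertex_cases)
    moreover from y obtain d t where "d < L" "t < W" "y = d * W + t" by (rule vertex_cases)
    ultimately show "v = y" using \<open>tau J v = tau J y\<close> slotV by (simp add: tau_J eq_index)
  qed
  moreover have "fval J v \<le> g v" if "v \<in> vertices J" for v
  proof -
    from that obtain c s where v: "c < L" "s < W" "v = c * W + s" by (rule vertex_cases)
    then show ?thesis using fs_tile[of s] fs_conflict[of s] by (cases "s < K") (auto simp: f_J g)
  qed
  ultimately show ?thesis unfolding extendable_to_minimal_rhf_def by blast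
qed

lemma J_in_ext_RHF: "J \<in> ext_RHF \<longleftrightarrow> (\<exists>\<sigma>. valid_tiling \<sigma>)"
  using J_instance tiling_of_extension extension_of_tiling unfolding ext_RHF_def by blast

end

section \<open>Accepting computations as tilings\<close>

type_synonym transition = "nat \<times> nat list \<times> nat \<times> (nat \<times> move) list"

text \<open>Halting depends only on the state and the scanned symbols, so the last condition
  confines idling to configurations in which M has halted. The bound A keeps the set finite.\<close>

definition idle_transitions :: "nat \<Rightarrow> tm \<Rightarrow> transition set" where
  "idle_transitions A M = {(1, as, 1, map (\<lambda>a. (a, Stay)) as) | as.
     length as = tapes M \<and> set as \<subseteq> {..<A} \<and> (\<nexists>q bs. (1, as, q, bs) \<in> trans M)}"

definition idling :: "nat \<Rightarrow> tm \<Rightarrow> tm" where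
  "idling A M = M\<lparr>trans := trans M \<union> idle_transitions A M\<rparr>"

type_synonym cell = "(nat \<times> bool) list"

text \<open>A constraint sees only two tiles, whereas the next content of a cell depends on three
  cells, as a head may arrive from either side, and on the transition, which is common to all heads.
  So a tile carries a window of three cells and the transition of its row.\<close>

datatype tile = Tile (border: bool) (rule: transition) (left_cell: cell) (mid_cell: cell) (right_cell: cell)

definition view :: "tape list \<Rightarrow> nat \<Rightarrow> cell" where
  "view ts i = map (\<lambda>t. (fst t i, snd t = i)) ts"

lemma length_view [simp]: "length (view ts i) = length ts"
  by (simp add: view_def)

text \<open>A head is in the middle cell afterwards if it stays there, comes from the left or comes
  from the right. The flag b marks cell 0, where a head moving left stays and the left cell x means
  nothing.\<close>

definition next_cell :: "bool \<Rightarrow> (nat \<times> move) list \<Rightarrow> cell \<Rightarrow> cell \<Rightarrow> cell \<Rightarrow> cell" where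
  "next_cell b bs x y z = map (\<lambda>j.
     (if snd (y ! j) then fst (bs ! j) else fst (y ! j),
      snd (y ! j) \<and> (snd (bs ! j) = Stay \<or> snd (bs ! j) = Go_Left \<and> b) \<or>
      \<not> b \<and> snd (x ! j) \<and> snd (bs ! j) = Go_Right \<or>
      snd (z ! j) \<and> snd (bs ! j) = Go_Left)) [0..<length bs]"

locale ntm =
  fixes M :: tm and A :: nat
  assumes wf: "wf_tm M" and A: "4 \<le> A"
    and symbols: "\<And>q as q' bs. (q, as, q', bs) \<in> trans M \<Longrightarrow> set as \<subseteq> {..<A} \<and> fst ` set bs \<subseteq> {..<A}"
begin

abbreviation "k \<equiv> tapes M"
abbreviation "M' \<equiv> idling A M"

definition blank_cell :: cell where
  "blank_cell = replicate k (0, False)"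

definition cells :: "cell set" where
  "cells = {z. set z \<subseteq> {..<A} \<times> UNIV \<and> length z = k}"

text \<open>By the last condition, a tile compares the symbols under its heads with the transition.
  Over a whole row this checks the entire list of scanned symbols.\<close>

definition tile_set :: "tile set" where
  "tile_set = {Tile b r x y z | b r x y z. r \<in> trans M' \<and> x \<in> cells \<and> y \<in> cells \<and> z \<in> cells \<and>
     (\<forall>j<k. snd (y ! j) \<longrightarrow> fst (y ! j) = fst (snd r) ! j)}"

text \<open>\<open>a\<close> is the input symbol of the cell. The marker 1 occurs only in cell 0, so
  the symbol alone tells whether the cell is the border, where all heads start. The neighbouring
  cells are left to \<open>horizontal\<close>.\<close>

definition initial :: "nat \<Rightarrow> tile \<Rightarrow> bool" where
  "initial a x \<longleftrightarrow> border x = (a = 1) \<and> (a = 1 \<longrightarrow> fst (rule x) = 0) \<and>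
     mid_cell x = (a, a = 1) # replicate (k - 1) (if a = 1 then 1 else 0, a = 1)"

text \<open>
  In the line of cells, a border tile comes right after the last tile of the previous row, with
  which it has nothing to do.
\<close>

definition horizontal :: "tile \<Rightarrow> tile \<Rightarrow> bool" where
  "horizontal x y \<longleftrightarrow> (if border y then right_cell x = blank_cell
     else rule x = rule y \<and> mid_cell x = left_cell y \<and> right_cell x = mid_cell y)"

definition vertical :: "tile \<Rightarrow> tile \<Rightarrow> bool" where
  "vertical x y \<longleftrightarrow> border x = border y \<and> fst (snd (snd (rule x))) = fst (rule y) \<and>
     mid_cell y = next_cell (border x) (snd (snd (snd (rule x)))) (left_cell x) (mid_cell x) (right_cell x)"

section \<open>Finiteness of the tile set\<close>

lemma k_pos: "0 < k" using wf by (simp add: wf_tm_def)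

lemma tapes_idling [simp]: "tapes M' = k" by (simp add: idling_def)

lemma trans_idling: "trans M' = trans M \<union> idle_transitions A M" by (simp add: idling_def)

lemma trans_props:
  assumes "(q, as, q', bs) \<in> trans M'"
  shows "length as = k" "length bs = k" "set as \<subseteq> {..<A}" "fst ` set bs \<subseteq> {..<A}"
proof -
  have "length as = k \<and> length bs = k \<and> set as \<subseteq> {..<A} \<and> fst ` set bs \<subseteq> {..<A}"
    using assms wf symbols[of q as q' bs] unfolding trans_idling
    by (fastforce simp: wf_tm_def idle_transitions_def)
  then show "length as = k" "length bs = k" "set as \<subseteq> {..<A}" "fst ` set bs \<subseteq> {..<A}" by auto
qed

lemma finite_trans: "finite (trans M')"
proof -
  have "idle_transitions A M \<subseteq> (\<lambda>as. (1, as, 1, map (\<lambda>a. (a, Stay)) as)) ` {as. set as \<subseteq> {..<A} \<and> length as = k}"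
    by (auto simp: idle_transitions_def)
  moreover have "finite {as :: nat list. set as \<subseteq> {..<A} \<and> length as = k}"
    by (rule finite_lists_length_eq) simp
  ultimately have "finite (idle_transitions A M)" by (meson finite_imageI finite_subset)
  then show ?thesis using wf by (simp add: trans_idling wf_tm_def)
qed

lemma finite_tile_set: "finite tile_set"
proof -
  have "finite cells" unfolding cells_def by (rule finite_lists_length_eq) simp
  then have fin: "finite ((UNIV :: bool set) \<times> trans M' \<times> cells \<times> cells \<times> cells)"
    using finite_trans by (intro finite_cartesian_product) auto
  have "tile_set \<subseteq> (\<lambda>(b, r, x, y, z). Tile b r x y z) ` (UNIV \<times> trans M' \<times> cells \<times> cells \<times> cells)"
  proof
    fix a assume "a \<in> tile_set"
    then have "(border a, rule a, left_cell a, mid_cell a, right_cell a) \<in> UNIV \<times> trans M' \<times> cells \<times> cells \<times> cells"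
      by (auto simp: tile_set_def)
    then show "a \<in> (\<lambda>(b, r, x, y, z). Tile b r x y z) ` (UNIV \<times> trans M' \<times> cells \<times> cells \<times> cells)"
      by (rule rev_image_eqI) simp
  qed
  then show ?thesis using fin by (meson finite_imageI finite_subset)
qed

text \<open>If M itself has no transition in state 1 on blanks, idling supplies one. This yields the
  positive number of tiles that \<open>tiling\<close> asks for.\<close>

lemma tile_set_nonempty: "tile_set \<noteq> {}"
proof -
  let ?as = "replicate k 0 :: nat list"
  have "\<exists>r. r \<in> trans M'"
  proof (cases "\<exists>q bs. (1, ?as, q, bs) \<in> trans M")
    case False
    then have "(1, ?as, 1, map (\<lambda>a. (a, Stay)) ?as) \<in> idle_transitions A M"
      unfolding idle_transitions_def using A by (intro CollectI exI[of _ ?as]) auto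
    then show ?thesis unfolding trans_idling by blast
  qed (auto simp: trans_idling)
  then obtain r where "r \<in> trans M'" ..
  moreover have "blank_cell \<in> cells" using A by (auto simp: cells_def blank_cell_def)
  moreover have "\<forall>j<k. \<not> snd (blank_cell ! j)" by (simp add: blank_cell_def)
  ultimately have "Tile True r blank_cell blank_cell blank_cell \<in> tile_set"
    unfolding tile_set_def by blast
  then show ?thesis by blast
qed

section \<open>Runs of the idling machine\<close>

lemma step_idling_cases: "step M' c d \<Longrightarrow> step M c d \<or> halted M c \<and> fst c = 1"
  unfolding step_def trans_idling halted_def by (auto simp: idle_transitions_def)

lemma run_idling_cases:
  "(step M' ^^ n) c d \<Longrightarrow> (step M ^^ n) c d \<or> (\<exists>e. (step M)\<^sup>*\<^sup>* c e \<and> halted M e \<and> fst e = 1)"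
proof (induction n arbitrary: d)
  case (Suc n)
  from Suc.prems obtain e where e: "(step M' ^^ n) c e" "step M' e d" by (rule relpowp_Suc_E)
  from Suc.IH[OF e(1)] show ?case
  proof
    assume *: "(step M ^^ n) c e"
    then have "(step M)\<^sup>*\<^sup>* c e" by (rule relpowp_imp_rtranclp)
    from step_idling_cases[OF e(2)] show ?thesis
    proof
      assume "step M e d"
      with * have "(step M ^^ Suc n) c d" by (rule relpowp_Suc_I)
      then show ?thesis ..
    qed (use \<open>(step M)\<^sup>*\<^sup>* c e\<close> in blast)
  qed blast
qed simp

text \<open>The run is too long for M, so it idles at some point, and the first time it does, M
  itself has reached a halted accepting configuration.\<close>

lemma accepts_of_run:
  assumes "runs_in_time M p" "poly p (length w) < n" "(step M' ^^ n) (init_config M w) d"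
  shows "accepts M w"
  using run_idling_cases[OF assms(3)] assms(1,2) unfolding runs_in_time_def accepts_def by fastforce

text \<open>For \<open>h < N\<close> all heads and all non-blank symbols lie in the first N cells,
  so a row of N tiles shows the whole configuration.\<close>

definition tame :: "nat \<Rightarrow> nat \<Rightarrow> config \<Rightarrow> bool" where
  "tame N h c \<longleftrightarrow> length (snd c) = k \<and>
     (\<forall>j<k. snd (snd c ! j) \<le> h \<and> (\<forall>i\<ge>N. fst (snd c ! j) i = 0) \<and> (\<forall>i. fst (snd c ! j) i < A))"

lemma tame_init: "length w < N \<Longrightarrow> tame N 0 (init_config M w)"
  using k_pos A by (auto simp: tame_def init_config_def string_tape_def nth_Cons bit_symbol_def split: nat.split)

lemma move_head_le: "move_head d h \<le> Suc h"
  by (cases d) auto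

lemma tame_step:
  assumes "tame N h c" "h < N" "step M' c d"
  shows "tame N (Suc h) d"
proof -
  from assms(3) obtain bs where bs: "(fst c, map scanned (snd c), fst d, bs) \<in> trans M'"
    and d: "snd d = map2 act bs (snd c)" unfolding step_def by blast
  have len: "length (snd c) = k" "length bs = k" using assms(1) trans_props[OF bs] by (auto simp: tame_def)
  have "snd (snd d ! j) \<le> Suc h \<and> (\<forall>i\<ge>N. fst (snd d ! j) i = 0) \<and> (\<forall>i. fst (snd d ! j) i < A)" if j: "j < k" for j
  proof -
    have "fst (bs ! j) < A" using trans_props(4)[OF bs] j len by (auto simp: image_subset_iff)
    moreover have "snd d ! j = act (bs ! j) (snd c ! j)" using j len by (simp add: d)
    moreover have "move_head (snd (bs ! j)) (snd (snd c ! j)) \<le> Suc h"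
      using move_head_le[of "snd (bs ! j)" "snd (snd c ! j)"] assms(1) j
      unfolding tame_def by (meson Suc_le_mono le_trans)
    ultimately show ?thesis using assms(1,2) j by (auto simp: tame_def act_def)
  qed
  then show ?thesis using len by (simp add: tame_def d)
qed

lemma tame_mono: "tame N h c \<Longrightarrow> h \<le> h' \<Longrightarrow> tame N h' c"
  unfolding tame_def by (meson le_trans)

lemma tame_length: "tame N h c \<Longrightarrow> length (snd c) = k"
  by (simp add: tame_def)

lemma tame_symbol: "tame N h c \<Longrightarrow> t \<in> set (snd c) \<Longrightarrow> fst t i < A"
  unfolding tame_def by (metis in_set_conv_nth)

lemma idle_step:
  assumes "tame N h c" "halted M c" "fst c = 1"
  shows "step M' c c"
proof -
  let ?as = "map scanned (snd c)"
  have "(1, ?as, q, bs) \<notin> trans M" for q bs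
    using assms(2,3) unfolding halted_def step_def by (metis fst_conv snd_conv)
  moreover have "set ?as \<subseteq> {..<A}" "length ?as = k"
    using tame_symbol[OF assms(1)] tame_length[OF assms(1)] by (auto simp: scanned_def)
  ultimately have "(1, ?as, 1, map (\<lambda>a. (a, Stay)) ?as) \<in> trans M'"
    by (auto simp: trans_idling idle_transitions_def)
  moreover have "map2 act (map (\<lambda>a. (a, Stay)) ?as) ts = ts" if "?as = map scanned ts" for ts
    using that by (auto simp: act_def scanned_def intro!: nth_equalityI)
  ultimately show ?thesis using assms(3) unfolding step_def by fastforce
qed

text \<open>An accepting run of length \<open>T < N\<close> has its heads at most at T. Repeating
  its last configuration forever keeps that bound and spares end conditions in the tiling.\<close>

lemma run_of_accepts:
  assumes "runs_in_time M p" "poly p (length w) < N" "length w < N" "accepts M w"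
  obtains C h where "C 0 = init_config M w" "\<And>t. step M' (C t) (C (Suc t))" "h < N" "\<And>t. tame N h (C t)"
proof -
  obtain c where c: "(step M)\<^sup>*\<^sup>* (init_config M w) c" "halted M c" "fst c = 1"
    using assms(4) unfolding accepts_def by blast
  from c(1) obtain T where T: "(step M ^^ T) (init_config M w) c"
    by (meson rtranclp_imp_relpowp)
  then have TN: "T < N" using assms(1,2) unfolding runs_in_time_def by (meson le_less_trans)
  from T obtain f where f: "f 0 = init_config M w" "f T = c" "\<And>i. i < T \<Longrightarrow> step M (f i) (f (Suc i))"
    unfolding relpowp_fun_conv by blast
  define C where "C t = f (min t T)" for t
  have tame: "t \<le> T \<Longrightarrow> tame N t (f t)" for t
  proof (induction t)
    case 0
    show ?case using f tame_init[OF assms(3)] by simp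
  next
    case (Suc t)
    have "step M' (f t) (f (Suc t))"
      using f(3)[of t] Suc.prems unfolding step_def trans_idling by auto
    then show ?case using Suc TN by (intro tame_step) auto
  qed
  have tameC: "tame N T (C t)" for t
    unfolding C_def by (rule tame_mono[OF tame]) auto
  show thesis
  proof
    show "C 0 = init_config M w" using f by (simp add: C_def)
    show "T < N" by fact
    show "tame N T (C t)" for t by (rule tameC)
    show "step M' (C t) (C (Suc t))" for t
    proof (cases "t < T")
      case True
      then show ?thesis using f(3)[of t] unfolding C_def step_def trans_idling by (auto simp: min_def)
    next
      case False
      then have "C t = c" "C (Suc t) = c" using f by (auto simp: C_def min_def)
      then show ?thesis using idle_step[of N T c] tameC[of t] c by simp
    qed
  qed
qed

text \<open>For \<open>i = 0\<close> the cell x need not be a view: it is the left cell of a border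
  tile, which no constraint determines.\<close>

lemma next_cell_view:
  assumes "length bs = length ts" "length x = length ts" "i \<noteq> 0 \<Longrightarrow> x = view ts (i - 1)"
  shows "next_cell (i = 0) bs x (view ts i) (view ts (i + 1)) = view (map2 act bs ts) i"
proof (rule nth_equalityI)
  show "length (next_cell (i = 0) bs x (view ts i) (view ts (i + 1))) = length (view (map2 act bs ts) i)"
    using assms by (simp add: next_cell_def view_def)
  fix j assume "j < length (next_cell (i = 0) bs x (view ts i) (view ts (i + 1)))"
  then have j: "j < length ts" using assms by (simp add: next_cell_def)
  obtain b d where b: "bs ! j = (b, d)" by (cases "bs ! j") auto
  obtain u h where u: "ts ! j = (u, h)" by (cases "ts ! j") auto
  show "next_cell (i = 0) bs x (view ts i) (view ts (i + 1)) ! j = view (map2 act bs ts) i ! j"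
    using j assms b u by (cases "i = 0"; cases d) (auto simp: next_cell_def view_def act_def)
qed

lemma view_init: "view (snd (init_config M w)) i =
    (fst (string_tape w) i, i = 0) # replicate (k - 1) (if i = 0 then 1 else 0, i = 0)"
  by (auto simp: view_def init_config_def string_tape_def)

lemma string_tape_marker: "fst (string_tape w) i = 1 \<longleftrightarrow> i = 0"
  by (auto simp: string_tape_def bit_symbol_def)

text \<open>Cell N lies just right of a row; this is the blank cell that \<open>horizontal\<close>
  demands before a border tile.\<close>

lemma tame_view_blank:
  assumes "tame N h c" "h < N"
  shows "view (snd c) N = blank_cell"
proof (rule nth_equalityI)
  show "length (view (snd c) N) = length blank_cell" using assms by (simp add: view_def blank_cell_def tame_def)
  fix j assume "j < length (view (snd c) N)"
  then have j: "j < k" using assms by (simp add: view_def tame_def)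
  then have "snd (snd c ! j) \<le> h" "fst (snd c ! j) N = 0" using assms(1) by (auto simp: tame_def)
  then show "view (snd c) N ! j = blank_cell ! j"
    using j assms by (auto simp: view_def blank_cell_def tame_def)
qed

lemma tame_view_cells: "tame N h c \<Longrightarrow> view (snd c) i \<in> cells"
  using tame_symbol[of N h c] tame_length[of N h c] by (fastforce simp: cells_def view_def)

lemma tiling_of_run:
  assumes "runs_in_time M p" "poly p (length w) < N" "length w < N" "accepts M w"
  obtains \<sigma> where "\<And>c. \<sigma> c \<in> tile_set" "\<And>c. c < N \<Longrightarrow> initial (fst (string_tape w) c) (\<sigma> c)"
    "\<And>c. horizontal (\<sigma> c) (\<sigma> (c + 1))" "\<And>c. vertical (\<sigma> c) (\<sigma> (c + N))"
proof -
  obtain C h where C: "C 0 = init_config M w" "\<And>t. step M' (C t) (C (Suc t))" "h < N" "\<And>t. tame N h (C t)"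
    using run_of_accepts[OF assms] by metis
  have "\<exists>bs. \<forall>t. (fst (C t), map scanned (snd (C t)), fst (C (Suc t)), bs t) \<in> trans M' \<and>
      snd (C (Suc t)) = map2 act (bs t) (snd (C t))"
    using C(2) unfolding step_def by (intro choice) blast
  then obtain bs where tr: "\<And>t. (fst (C t), map scanned (snd (C t)), fst (C (Suc t)), bs t) \<in> trans M'"
    and bs: "\<And>t. snd (C (Suc t)) = map2 act (bs t) (snd (C t))" by blast
  define r where "r t = (fst (C t), map scanned (snd (C t)), fst (C (Suc t)), bs t)" for t
  \<comment> \<open>At \<open>i = 0\<close> the truncated subtraction gives cell 0 as a dummy left
    cell; it only has to belong to \<open>cells\<close>.\<close>
  define tl where "tl t i = Tile (i = 0) (r t) (view (snd (C t)) (i - 1)) (view (snd (C t)) i) (view (snd (C t)) (i + 1))" for t i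
  define \<sigma> where "\<sigma> c = tl (c div N) (c mod N)" for c
  have N: "0 < N" using assms by simp
  have len: "length (snd (C t)) = k" "length (bs t) = k" for t
    using C(4)[of t] trans_props[OF tr[of t]] by (auto simp: tame_def)
  show thesis
  proof
    fix c
    have "tl t i \<in> tile_set" for t i
    proof -
      have "\<forall>j<k. snd (view (snd (C t)) i ! j) \<longrightarrow> fst (view (snd (C t)) i ! j) = fst (snd (r t)) ! j"
        using len by (simp add: r_def view_def scanned_def)
      moreover have "r t \<in> trans M'" using tr by (simp add: r_def)
      ultimately show ?thesis
        unfolding tl_def tile_set_def using tame_view_cells[OF C(4)] by blast
    qed
    then show "\<sigma> c \<in> tile_set" by (simp add: \<sigma>_def)
    show "initial (fst (string_tape w) c) (\<sigma> c)" if "c < N"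
    proof -
      have "fst (C 0) = 0" by (simp add: C(1) init_config_def)
      then show ?thesis
        using that string_tape_marker[of w c] view_init[of w c] C(1)
        by (auto simp: \<sigma>_def tl_def initial_def r_def)
    qed
    show "horizontal (\<sigma> c) (\<sigma> (c + 1))"
    proof (cases "Suc (c mod N) = N")
      \<comment> \<open>The next tile is the border tile of the following row, so only the blank
        cell N is at stake.\<close>
      case True
      then show ?thesis using tame_view_blank[OF C(4) C(3)]
        by (simp add: \<sigma>_def tl_def horizontal_def mod_Suc)
    next
      case False
      then show ?thesis by (simp add: \<sigma>_def tl_def horizontal_def mod_Suc div_Suc)
    qed
    show "vertical (\<sigma> c) (\<sigma> (c + N))"
      using N next_cell_view[of "bs (c div N)" "snd (C (c div N))" "view (snd (C (c div N))) (c mod N - 1)" "c mod N"] len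
      by (simp add: \<sigma>_def tl_def vertical_def r_def bs)
  qed
qed

text \<open>The middle cells of row t show the tapes after t steps. The vertical constraints keep
  the border in column 0, the horizontal ones keep the transition constant along a row, and
  \<open>tile_set\<close> makes it fit the scanned symbols.\<close>

lemma run_of_tiling:
  assumes tiles: "\<And>c. c < m + N \<Longrightarrow> \<sigma> c \<in> tile_set" and m: "N * N \<le> m" and N: "length w < N"
    and init: "\<And>c. c < N \<Longrightarrow> initial (fst (string_tape w) c) (\<sigma> c)"
    and hor: "\<And>c. c < m \<Longrightarrow> horizontal (\<sigma> c) (\<sigma> (c + 1))"
    and ver: "\<And>c. c < m \<Longrightarrow> vertical (\<sigma> c) (\<sigma> (c + N))"
  shows "\<exists>d. (step M' ^^ N) (init_config M w) d"
proof -
  define tl where "tl t i = \<sigma> (t * N + i)" for t i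
  have idx: "t * N + i < N * N" if "t < N" "i < N" for t i
  proof -
    have "t * N + i < Suc t * N" using that by simp
    also have "\<dots> \<le> N * N" using that by (intro mult_le_mono1) simp
    finally show ?thesis .
  qed
  have tl: "tl t i \<in> tile_set" if "t < N" "i < N" for t i
    using tiles idx[OF that] m by (simp add: tl_def)
  have H: "horizontal (tl t i) (tl t (Suc i))" if "t < N" "i < N" for t i
    using hor[of "t * N + i"] idx[OF that] m by (simp add: tl_def)
  have wrap: "tl t N = tl (Suc t) 0" for t by (simp add: tl_def add.commute)
  have V: "vertical (tl t i) (tl (Suc t) i)" if "t < N" "i < N" for t i
    using ver[of "t * N + i"] idx[OF that] m by (simp add: tl_def algebra_simps)
  have border: "border (tl t i) \<longleftrightarrow> i = 0" if "t \<le> N" "i < N" for t i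
    using that
  proof (induction t)
    case 0
    then show ?case using init[of i] string_tape_marker by (simp add: tl_def initial_def)
  next
    case (Suc t)
    then show ?case using V[of t i] by (simp add: vertical_def)
  qed
  have "\<exists>c. (step M' ^^ t) (init_config M w) c \<and> tame N t c \<and> fst c = fst (rule (tl t 0)) \<and>
      (\<forall>i<N. mid_cell (tl t i) = view (snd c) i)" if "t \<le> N" for t
    using that
  proof (induction t)
    case 0
    have "\<forall>i<N. mid_cell (tl 0 i) = view (snd (init_config M w)) i"
      using init string_tape_marker by (simp add: tl_def initial_def view_init)
    moreover have "fst (rule (tl 0 0)) = 0"
      using init[of 0] N string_tape_marker[of w 0] by (auto simp: tl_def initial_def)
    ultimately show ?case using tame_init[OF N] by (auto simp: init_config_def)
  next
    case (Suc t)
    then obtain c where run: "(step M' ^^ t) (init_config M w) c" and tame: "tame N t c"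
      and st: "fst c = fst (rule (tl t 0))" and mid: "\<And>i. i < N \<Longrightarrow> mid_cell (tl t i) = view (snd c) i"
      by auto
    have t: "t < N" using Suc.prems by simp
    obtain q as q' bs where r: "rule (tl t 0) = (q, as, q', bs)" by (metis prod_cases4)
    have rule: "rule (tl t i) = (q, as, q', bs)" if "i < N" for i
      using that
    proof (induction i)
      case (Suc i)
      then show ?case using H[of t i] border[of t "Suc i"] t by (simp add: horizontal_def)
    qed (rule r)
    have tr: "(q, as, q', bs) \<in> trans M'" using tl[OF t, of 0] r N by (auto simp: tile_set_def)
    have len: "length (snd c) = k" "length as = k" "length bs = k"
      using tame trans_props[OF tr] by (auto simp: tame_def)
    have "map scanned (snd c) = as"
    proof (rule nth_equalityI)
      fix j assume "j < length (map scanned (snd c))"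
      then have j: "j < k" using len by simp
      \<comment> \<open>The tile at the position of head j is the one that checks the scanned symbol
        j.\<close>
      define i where "i = snd (snd c ! j)"
      have i: "i < N" using tame j t by (auto simp: tame_def i_def)
      have "view (snd c) i ! j = (scanned (snd c ! j), True)"
        using j len by (simp add: view_def i_def scanned_def)
      then have "scanned (snd c ! j) = fst (snd (rule (tl t i))) ! j"
        using tl[OF t i] mid[OF i] j by (auto simp: tile_set_def)
      then show "map scanned (snd c) ! j = as ! j" using rule[OF i] j len by simp
    qed (use len in simp)
    then have step: "step M' c (q', map2 act bs (snd c))"
      unfolding step_def using tr st r by auto
    have "mid_cell (tl (Suc t) i) = view (map2 act bs (snd c)) i" if i: "i < N" for i
    proof -
      have right: "right_cell (tl t i) = view (snd c) (i + 1)"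
      proof (cases "Suc i < N")
        case True
        then show ?thesis using H[OF t i] border[of t "Suc i"] t mid[OF True] by (simp add: horizontal_def)
      next
        case False
        \<comment> \<open>The successor of the last tile in a row is the border tile of the next
          row, which forces a blank right cell.\<close>
        then have "Suc i = N" using i by simp
        then show ?thesis
          using H[OF t i] border[of "Suc t" 0] Suc.prems i wrap[of t] tame_view_blank[OF tame t]
          by (simp add: horizontal_def)
      qed
      have left: "left_cell (tl t i) = view (snd c) (i - 1)" if "i \<noteq> 0"
      proof -
        from that obtain i' where i': "i = Suc i'" by (cases i) auto
        then show ?thesis using H[of t i'] border[of t i] t i mid[of i'] by (simp add: horizontal_def)
      qed
      have "length (left_cell (tl t i)) = k" using tl[OF t i] by (auto simp: tile_set_def cells_def)
      then have "next_cell (i = 0) bs (left_cell (tl t i)) (view (snd c) i) (view (snd c) (i + 1)) =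
          view (map2 act bs (snd c)) i"
        using len left by (intro next_cell_view) auto
      then show ?thesis
        using V[OF t i] border[of t i] t i rule[OF i] mid[OF i] right by (simp add: vertical_def)
    qed
    moreover have "fst (rule (tl (Suc t) 0)) = q'" using V[OF t, of 0] N r by (simp add: vertical_def)
    ultimately show ?case
      using relpowp_Suc_I[OF run step] tame_step[OF tame t step] by (intro exI[of _ "(q', map2 act bs (snd c))"]) simp
  qed
  from this[OF order_refl] show ?thesis by blast
qed

end

section \<open>Counter programs\<close>

text \<open>
  A tape that is never written serves as a counter, its value being the head position; the
  left-end marker tells whether it is zero. The input tape is such a counter as well.
\<close>

datatype com = Skip | Inc nat | Dec nat | Out bool | Seq com com (infixr ";;" 60)
  | While nat nat com | If_Sym nat nat com com

type_synonym cstate = "(nat \<Rightarrow> nat) \<times> bool list"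

text \<open>Counter tapes are never written, so their contents depend on w only: tape 0 holds the
  input, the others just the marker.\<close>

definition cell_content :: "bool list \<Rightarrow> nat \<Rightarrow> nat \<Rightarrow> nat" where
  "cell_content w j = fst (string_tape (if j = 0 then w else []))"

text \<open>The times are exact numbers of machine steps. The second 1 in \<open>While_True\<close>
  and \<open>If_True\<close> pays for the jump after the body and after the first branch.\<close>

inductive big :: "bool list \<Rightarrow> com \<Rightarrow> cstate \<Rightarrow> nat \<Rightarrow> cstate \<Rightarrow> bool" for w where
  Skip: "big w Skip s 0 s"
| Inc: "big w (Inc r) (h, out) 1 (h(r := h r + 1), out)"
| Dec: "big w (Dec r) (h, out) 1 (h(r := h r - 1), out)"
| Out: "big w (Out b) (h, out) 1 (h, out @ [b])"
| Seq: "big w c1 s t1 s1 \<Longrightarrow> big w c2 s1 t2 s2 \<Longrightarrow> big w (c1 ;; c2) s (t1 + t2) s2"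
| While_False: "cell_content w r (fst s r) = a \<Longrightarrow> big w (While r a c) s 1 s"
| While_True: "cell_content w r (fst s r) \<noteq> a \<Longrightarrow> big w c s t1 s1 \<Longrightarrow> big w (While r a c) s1 t2 s2 \<Longrightarrow>
    big w (While r a c) s (1 + t1 + 1 + t2) s2"
| If_True: "cell_content w r (fst s r) = a \<Longrightarrow> big w c1 s t s' \<Longrightarrow>
    big w (If_Sym r a c1 c2) s (1 + t + 1) s'"
| If_False: "cell_content w r (fst s r) \<noteq> a \<Longrightarrow> big w c2 s t s' \<Longrightarrow>
    big w (If_Sym r a c1 c2) s (1 + t) s'"

fun counters :: "com \<Rightarrow> nat set" where
  "counters Skip = {}"
| "counters (Inc r) = {r}"
| "counters (Dec r) = {r}"
| "counters (Out b) = {}"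
| "counters (c1 ;; c2) = counters c1 \<union> counters c2"
| "counters (While r a c) = insert r (counters c)"
| "counters (If_Sym r a c1 c2) = insert r (counters c1 \<union> counters c2)"


subsection \<open>Compilation to Turing machines\<close>

datatype instr = Move nat move | Print bool | Test nat nat nat nat

fun code_size :: "com \<Rightarrow> nat" where
  "code_size Skip = 0"
| "code_size (Inc r) = 1"
| "code_size (Dec r) = 1"
| "code_size (Out b) = 1"
| "code_size (c1 ;; c2) = code_size c1 + code_size c2"
| "code_size (While r a c) = code_size c + 2"
| "code_size (If_Sym r a c1 c2) = code_size c1 + code_size c2 + 2"

text \<open>p is the address of the first instruction. A test with two equal targets serves as a
  jump.\<close>

fun code :: "com \<Rightarrow> nat \<Rightarrow> instr list" where
  "code Skip p = []"
| "code (Inc r) p = [Move r Go_Right]"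
| "code (Dec r) p = [Move r Go_Left]"
| "code (Out b) p = [Print b]"
| "code (c1 ;; c2) p = code c1 p @ code c2 (p + code_size c1)"
| "code (While r a c) p =
     Test r a (p + code_size c + 2) (p + 1) # code c (p + 1) @ [Test r a p p]"
| "code (If_Sym r a c1 c2) p =
     Test r a (p + 1) (p + code_size c1 + 2) # code c1 (p + 1) @
     [Test r a (p + code_size c1 + code_size c2 + 2) (p + code_size c1 + code_size c2 + 2)] @
     code c2 (p + code_size c1 + 2)"

lemma length_code [simp]: "length (code c p) = code_size c"
  by (induction c arbitrary: p) auto

text \<open>The number of counter tapes is n; the output tape has index n.\<close>

fun instr_effect :: "nat \<Rightarrow> nat \<Rightarrow> instr \<Rightarrow> nat list \<Rightarrow> nat \<times> (nat \<times> move) list" where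
  "instr_effect n p (Move r d) as = (p + 1, (map (\<lambda>a. (a, Stay)) as)[r := (as ! r, d)])"
| "instr_effect n p (Print b) as = (p + 1, (map (\<lambda>a. (a, Stay)) as)[n := (bit_symbol b, Go_Right)])"
| "instr_effect n p (Test r a q1 q2) as = (if as ! r = a then q1 else q2, map (\<lambda>a. (a, Stay)) as)"

text \<open>The state is the program counter. Addresses behind the program have no transition, so
  leaving the program means halting. Only the symbols 0 to 3 ever occur.\<close>

definition machine :: "nat \<Rightarrow> instr list \<Rightarrow> tm" where
  "machine n P = \<lparr>tapes = n + 1,
     trans = {(p, as, instr_effect n p (P ! p) as) | p as. p < length P \<and> length as = n + 1 \<and> set as \<subseteq> {..3}}\<rparr>"

section \<open>Correctness of the compiled machine\<close>

lemma length_instr_effect [simp]: "length (snd (instr_effect n p i as)) = length as"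
  by (cases i) auto

lemma wf_machine: "wf_tm (machine n P)"
proof -
  have "finite {as :: nat list. set as \<subseteq> {..3} \<and> length as = n + 1}"
    by (rule finite_lists_length_eq) simp
  then have "finite ((\<lambda>(p, as). (p, as, instr_effect n p (P ! p) as)) `
      ({..<length P} \<times> {as. set as \<subseteq> {..3} \<and> length as = n + 1}))"
    by simp
  moreover have "trans (machine n P) = (\<lambda>(p, as). (p, as, instr_effect n p (P ! p) as)) `
      ({..<length P} \<times> {as. set as \<subseteq> {..3} \<and> length as = n + 1})"
    by (auto simp: machine_def)
  ultimately have "finite (trans (machine n P))" by simp
  moreover have "length as = n + 1 \<and> length bs = n + 1" if "(q, as, q', bs) \<in> trans (machine n P)" for q as q' bs
  proof -
    have "(q', bs) = instr_effect n q (P ! q) as" "length as = n + 1"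
      using that by (auto simp: machine_def)
    then show ?thesis by (metis length_instr_effect snd_conv)
  qed
  moreover have "tapes (machine n P) = n + 1" by (simp add: machine_def)
  ultimately show ?thesis unfolding wf_tm_def by auto
qed

lemma deterministic_machine: "deterministic (machine n P)"
  unfolding deterministic_def machine_def by (auto simp: prod_eq_iff)

text \<open>The output head stands on the first blank after the output, where the next bit is to be
  printed.\<close>

definition machine_config :: "nat \<Rightarrow> bool list \<Rightarrow> nat \<Rightarrow> cstate \<Rightarrow> config" where
  "machine_config n w p s = (p, map (\<lambda>j. (cell_content w j, fst s j)) [0..<n] @
     [(fst (string_tape (snd s)), length (snd s) + 1)])"

lemma cell_content_le: "cell_content w j i \<le> 3" 
  by (auto simp: cell_content_def string_tape_def bit_symbol_def)

lemma act_stay: "act (scanned t, Stay) t = t"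
  by (simp add: act_def scanned_def)

lemma map2_act_stay: "map2 act (map (\<lambda>a. (a, Stay)) (map scanned ts)) ts = ts"
  by (induction ts) (auto simp: act_stay)

lemma map2_act_update:
  assumes "r < length ts"
  shows "map2 act ((map (\<lambda>a. (a, Stay)) (map scanned ts))[r := x]) ts = ts[r := act x (ts ! r)]"
  using assms by (intro nth_equalityI) (auto simp: nth_list_update act_stay)

lemma step_machine:
  assumes "p < length P" "instr_effect n p (P ! p) (map scanned ts) = (q, bs)"
    "length ts = n + 1" "\<forall>t\<in>set ts. scanned t \<le> 3"
  shows "step (machine n P) (p, ts) (q, map2 act bs ts)"
  unfolding step_def using assms by (auto simp: machine_def intro!: exI[of _ bs] exI[of _ "map scanned ts"])

lemma scanned_machine_config:
  "\<forall>t\<in>set (snd (machine_config n w p s)). scanned t \<le> 3"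
  using cell_content_le by (auto simp: machine_config_def scanned_def string_tape_def)

lemma step_move:
  assumes "p < length P" "P ! p = Move r d" "r < n"
  shows "step (machine n P) (machine_config n w p (h, out))
    (machine_config n w (p + 1) (h(r := move_head d (h r)), out))"
proof -
  let ?ts = "snd (machine_config n w p (h, out))"
  have len: "length ?ts = n + 1" by (simp add: machine_config_def)
  have "step (machine n P) (p, ?ts)
      (p + 1, map2 act ((map (\<lambda>a. (a, Stay)) (map scanned ?ts))[r := (map scanned ?ts ! r, d)]) ?ts)"
    using assms len scanned_machine_config by (intro step_machine) auto
  moreover have "map2 act ((map (\<lambda>a. (a, Stay)) (map scanned ?ts))[r := (map scanned ?ts ! r, d)]) ?ts =
      snd (machine_config n w (p + 1) (h(r := move_head d (h r)), out))"
    using assms by (subst map2_act_update)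
      (auto simp: machine_config_def nth_append act_def scanned_def nth_list_update intro!: nth_equalityI)
  ultimately show ?thesis by (simp add: machine_config_def)
qed

lemma string_tape_snoc:
  "fst (string_tape (out @ [b])) = (fst (string_tape out))(length out + 1 := bit_symbol b)"
  by (auto simp: string_tape_def nth_append fun_eq_iff)

lemma step_print:
  assumes "p < length P" "P ! p = Print b"
  shows "step (machine n P) (machine_config n w p (h, out)) (machine_config n w (p + 1) (h, out @ [b]))"
proof -
  let ?ts = "snd (machine_config n w p (h, out))"
  have len: "length ?ts = n + 1" by (simp add: machine_config_def)
  have "step (machine n P) (p, ?ts)
      (p + 1, map2 act ((map (\<lambda>a. (a, Stay)) (map scanned ?ts))[n := (bit_symbol b, Go_Right)]) ?ts)"
    using assms len scanned_machine_config by (intro step_machine) auto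
  moreover have "map2 act ((map (\<lambda>a. (a, Stay)) (map scanned ?ts))[n := (bit_symbol b, Go_Right)]) ?ts =
      snd (machine_config n w (p + 1) (h, out @ [b]))"
    by (subst map2_act_update)
      (auto simp: machine_config_def nth_append act_def string_tape_snoc list_update_append)
  ultimately show ?thesis by (simp add: machine_config_def)
qed

lemma step_test:
  assumes "p < length P" "P ! p = Test r a q1 q2" "r < n"
  shows "step (machine n P) (machine_config n w p s)
    (machine_config n w (if cell_content w r (fst s r) = a then q1 else q2) s)"
proof -
  let ?ts = "snd (machine_config n w p s)"
  let ?q = "if cell_content w r (fst s r) = a then q1 else q2"
  have len: "length ?ts = n + 1" by (simp add: machine_config_def)
  have "map scanned ?ts ! r = cell_content w r (fst s r)"
    using assms by (simp add: machine_config_def nth_append scanned_def)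
  then have "step (machine n P) (p, ?ts) (?q, map2 act (map (\<lambda>a. (a, Stay)) (map scanned ?ts)) ?ts)"
    using assms len scanned_machine_config by (intro step_machine) auto
  then show ?thesis unfolding map2_act_stay by (simp add: machine_config_def)
qed

definition code_at :: "instr list \<Rightarrow> nat \<Rightarrow> instr list \<Rightarrow> bool" where
  "code_at P p C \<longleftrightarrow> p + length C \<le> length P \<and> (\<forall>i<length C. P ! (p + i) = C ! i)"

lemma code_at_Nil [simp]: "code_at P p [] \<longleftrightarrow> p \<le> length P"
  by (simp add: code_at_def)

lemma code_at_Cons [simp]: "code_at P p (x # C) \<longleftrightarrow> p < length P \<and> P ! p = x \<and> code_at P (p + 1) C"
  unfolding code_at_def by (auto simp: All_less_Suc2)

lemma code_at_append [simp]: "code_at P p (C @ D) \<longleftrightarrow> code_at P p C \<and> code_at P (p + length C) D"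
proof (induction C arbitrary: p)
  case Nil
  show ?case by (auto simp: code_at_def)
qed simp

lemma big_imp_steps:
  assumes "big w c s t s'" "code_at P p (code c p)" "counters c \<subseteq> {..<n}"
  shows "(step (machine n P) ^^ t) (machine_config n w p s) (machine_config n w (p + code_size c) s')"
  using assms
proof (induction arbitrary: p rule: big.induct)
  case (Skip s)
  then show ?case by simp
next
  case (Inc r h out)
  then show ?case using step_move[of p P r Go_Right n w h out] by (simp add: eq_OO)
next
  case (Dec r h out)
  then show ?case using step_move[of p P r Go_Left n w h out] by (simp add: eq_OO)
next
  case (Out b h out)
  then show ?case using step_print[of p P b n w h out] by (simp add: eq_OO)
next
  case (Seq c1 s t1 s1 c2 t2 s2)
  let ?S = "step (machine n P)" and ?C = "machine_config n w"
  have "(?S ^^ t1) (?C p s) (?C (p + code_size c1) s1)"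
    using Seq.prems by (intro Seq.IH(1)) auto
  moreover have "(?S ^^ t2) (?C (p + code_size c1) s1) (?C (p + code_size c1 + code_size c2) s2)"
    using Seq.prems by (intro Seq.IH(2)) auto
  ultimately show ?case by (auto simp: relpowp_add add.assoc)
next
  case (While_False r s a c)
  then show ?case using step_test[of p P r a "p + code_size c + 2" "p + 1" n w s] by (simp add: eq_OO)
next
  case (While_True r s a c t1 s1 t2 s2)
  let ?S = "step (machine n P)" and ?C = "machine_config n w"
  have 1: "?S (?C p s) (?C (p + 1) s)"
    using While_True step_test[of p P r a "p + code_size c + 2" "p + 1" n w s] by simp
  have 2: "(?S ^^ t1) (?C (p + 1) s) (?C (p + 1 + code_size c) s1)"
    using While_True.prems by (intro While_True.IH(1)) auto
  have 3: "?S (?C (p + 1 + code_size c) s1) (?C p s1)"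
    using While_True.prems step_test[of "p + 1 + code_size c" P r a p p n w s1] by simp
  have 4: "(?S ^^ t2) (?C p s1) (?C (p + code_size (While r a c)) s2)"
    using While_True.prems by (intro While_True.IH(2)) auto
  have "(?S ^^ (1 + t1 + 1 + t2)) (?C p s) (?C (p + code_size (While r a c)) s2)"
    unfolding relpowp_add using 1 2 3 4 by auto
  then show ?case .
next
  case (If_True r s a c1 t s' c2)
  let ?S = "step (machine n P)" and ?C = "machine_config n w"
  let ?e = "p + code_size c1 + code_size c2 + 2"
  have 1: "?S (?C p s) (?C (p + 1) s)"
    using If_True step_test[of p P r a "p + 1" "p + code_size c1 + 2" n w s] by simp
  have 2: "(?S ^^ t) (?C (p + 1) s) (?C (p + 1 + code_size c1) s')"
    using If_True.prems by (intro If_True.IH) auto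
  have 3: "?S (?C (p + 1 + code_size c1) s') (?C ?e s')"
    using If_True.prems step_test[of "p + 1 + code_size c1" P r a ?e ?e n w s'] by simp
  have "(?S ^^ (1 + t + 1)) (?C p s) (?C ?e s')"
    unfolding relpowp_add using 1 2 3 by auto
  then show ?case by (simp add: add.assoc)
next
  case (If_False r s a c2 t s' c1)
  let ?S = "step (machine n P)" and ?C = "machine_config n w"
  have 1: "?S (?C p s) (?C (p + code_size c1 + 2) s)"
    using If_False step_test[of p P r a "p + 1" "p + code_size c1 + 2" n w s] by simp
  have 2: "(?S ^^ t) (?C (p + code_size c1 + 2) s) (?C (p + code_size c1 + 2 + code_size c2) s')"
    using If_False.prems by (intro If_False.IH) (auto simp: add.assoc)
  have "(?S ^^ (1 + t)) (?C p s) (?C (p + code_size c1 + 2 + code_size c2) s')"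
    unfolding relpowp_add using 1 2 by auto
  then show ?case by (simp add: add.assoc add.commute add.left_commute)
qed

lemma polytime_computableI:
  fixes p :: "nat poly"
  assumes n: "0 < n" "counters c \<subseteq> {..<n}"
    and c: "\<And>w. \<exists>t h. t \<le> poly p (length w) \<and> big w c (\<lambda>_. 0, []) t (h, F w)"
  shows "polytime_computable F"
proof -
  \<comment> \<open>The output head starts on the left-end marker, one cell before the position that
    \<open>machine_config\<close> requires. The additional instruction moves it and accounts for the
    1 added to p.\<close>
  define P where "P = Move n Go_Right # code c 1"
  let ?M = "machine n P"
  have at: "code_at P 1 (code c 1)" by (simp add: P_def code_at_def)
  have run: "\<exists>t c'. t \<le> poly (p + 1) (length w) \<and> (step ?M ^^ t) (init_config ?M w) c' \<and>
      halted ?M c' \<and> has_output c' (F w)" for w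
  proof -
    obtain t h where t: "t \<le> poly p (length w)" and b: "big w c (\<lambda>_. 0, []) t (h, F w)"
      using c by blast
    define ts where "ts = snd (init_config ?M w)"
    have ts: "ts = map (\<lambda>j. (cell_content w j, 0)) [0..<n] @ [string_tape []]"
    proof (rule nth_equalityI)
      show "length ts = length (map (\<lambda>j. (cell_content w j, 0 :: nat)) [0..<n] @ [string_tape []])"
        by (simp add: ts_def init_config_def machine_def)
      fix i assume "i < length ts"
      then show "ts ! i = (map (\<lambda>j. (cell_content w j, 0)) [0..<n] @ [string_tape []]) ! i"
        using n by (cases i)
          (auto simp: ts_def init_config_def machine_def nth_append cell_content_def string_tape_def)
    qed
    have sc: "\<forall>t\<in>set ts. scanned t \<le> 3"
      using cell_content_le by (auto simp: ts scanned_def string_tape_def)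
    have len: "length ts = n + 1" by (simp add: ts)
    have "step ?M (0, ts)
        (1, map2 act ((map (\<lambda>a. (a, Stay)) (map scanned ts))[n := (map scanned ts ! n, Go_Right)]) ts)"
      using sc len by (intro step_machine) (auto simp: P_def)
    moreover have "map2 act ((map (\<lambda>a. (a, Stay)) (map scanned ts))[n := (map scanned ts ! n, Go_Right)]) ts =
        snd (machine_config n w 1 (\<lambda>_. 0, []))"
      using len by (subst map2_act_update)
        (auto simp: ts machine_config_def nth_append act_def scanned_def string_tape_def fun_eq_iff list_update_append)
    ultimately have 1: "step ?M (init_config ?M w) (machine_config n w 1 (\<lambda>_. 0, []))"
      by (simp add: ts_def machine_config_def init_config_def)
    let ?c' = "machine_config n w (1 + code_size c) (h, F w)"
    have "(step ?M ^^ (1 + t)) (init_config ?M w) ?c'"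
      unfolding relpowp_add using 1 big_imp_steps[OF b at n(2)] by auto
    \<comment> \<open>The state has reached \<open>length P\<close>, which has no
      transition.\<close>
    moreover have "halted ?M ?c'"
      by (auto simp: halted_def step_def machine_def machine_config_def P_def)
    moreover have "has_output ?c' (F w)"
      by (auto simp: has_output_def machine_config_def string_tape_def)
    ultimately show ?thesis using t by (intro exI[of _ "1 + t"] exI[of _ ?c']) simp
  qed
  show ?thesis
    unfolding polytime_computable_def using wf_machine deterministic_machine run by blast
qed

section \<open>A program generating the instance\<close>

text \<open>Exact times become upper bounds, so that rounds of different cost have a common
  bound.\<close>

definition run :: "bool list \<Rightarrow> com \<Rightarrow> cstate \<Rightarrow> cstate \<Rightarrow> nat \<Rightarrow> bool" where
  "run w c s s' t \<longleftrightarrow> (\<exists>t'\<le>t. big w c s t' s')"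

lemma run_mono: "run w c s s' t \<Longrightarrow> t \<le> t' \<Longrightarrow> run w c s s' t'"
  unfolding run_def by (meson le_trans)

lemma run_Inc: "run w (Inc r) (h, out) (h(r := h r + 1), out) 1"
  unfolding run_def by (blast intro: big.Inc)

lemma run_Dec: "run w (Dec r) (h, out) (h(r := h r - 1), out) 1"
  unfolding run_def by (blast intro: big.Dec)

lemma run_Seq: "run w c1 s s1 t1 \<Longrightarrow> run w c2 s1 s2 t2 \<Longrightarrow> run w (c1 ;; c2) s s2 (t1 + t2)"
  unfolding run_def by (meson add_mono big.Seq)

lemma run_While:
  assumes "\<And>i. i < n \<Longrightarrow> cell_content w r (fst (S i) r) \<noteq> a"
    and "\<And>i. i < n \<Longrightarrow> run w c (S i) (S (Suc i)) t"
    and "cell_content w r (fst (S n) r) = a"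
  shows "run w (While r a c) (S 0) (S n) (n * (t + 2) + 1)"
  using assms
proof (induction n arbitrary: S)
  case 0
  then have "big w (While r a c) (S 0) 1 (S 0)" by (intro big.While_False)
  then show ?case unfolding run_def by auto
next
  case (Suc n)
  have "run w (While r a c) (S (Suc 0)) (S (Suc n)) (n * (t + 2) + 1)"
    using Suc.prems by (intro Suc.IH[of "\<lambda>i. S (Suc i)"]) auto
  then obtain t2 where t2: "t2 \<le> n * (t + 2) + 1" "big w (While r a c) (S (Suc 0)) t2 (S (Suc n))"
    unfolding run_def by blast
  obtain t1 where t1: "t1 \<le> t" "big w c (S 0) t1 (S (Suc 0))"
    using Suc.prems(2)[of 0] unfolding run_def by blast
  have "big w (While r a c) (S 0) (1 + t1 + 1 + t2) (S (Suc n))"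
    using Suc.prems(1)[of 0] t1 t2 by (intro big.While_True) auto
  moreover have "1 + t1 + 1 + t2 \<le> Suc n * (t + 2) + 1" using t1 t2 by simp
  ultimately show ?case unfolding run_def by blast
qed

lemma cell_content_marker: "cell_content w r i = Suc 0 \<longleftrightarrow> i = 0"
  by (auto simp: cell_content_def string_tape_def bit_symbol_def)

lemma run_countdown:
  assumes "\<And>i. i \<le> n \<Longrightarrow> fst (S i) r = n - i"
    and "\<And>i. i < n \<Longrightarrow> run w c (S i) (S (Suc i)) t"
  shows "run w (While r 1 c) (S 0) (S n) (n * (t + 2) + 1)"
  using assms by (intro run_While) (auto simp: cell_content_marker)

text \<open>Counter 2 is reserved for restoring the counter of a loop.\<close>

definition repeat :: "nat \<Rightarrow> com \<Rightarrow> com" where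
  "repeat r c = While r 1 (Dec r ;; Inc 2 ;; c) ;; While 2 1 (Dec 2 ;; Inc r)"

lemma run_move_counter:
  assumes "r \<noteq> q"
  shows "run w (While q 1 (Dec q ;; Inc r)) (h, out) (h(r := h r + h q, q := 0), out) (h q * 4 + 1)"
proof -
  define S where "S i = (h(r := h r + i, q := h q - i), out)" for i
  have "run w (While q 1 (Dec q ;; Inc r)) (S 0) (S (h q)) (h q * (2 + 2) + 1)"
  proof (rule run_countdown)
    fix i assume i: "i < h q"
    have "run w (Dec q ;; Inc r) (S i) (h(q := h q - Suc i, r := Suc (h r + i)), out) (1 + 1)"
      unfolding S_def
      by (rule run_Seq[OF run_Dec]) (use run_Inc[of w r "h(r := h r + i, q := h q - i - 1)" out] assms in
        \<open>simp add: fun_upd_twist\<close>)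
    then show "run w (Dec q ;; Inc r) (S i) (S (Suc i)) 2"
      using assms by (simp add: S_def fun_upd_twist numeral_2_eq_2)
  qed (simp add: S_def)
  then show ?thesis by (simp add: S_def)
qed

text \<open>\<open>h i\<close> describes the counters between rounds as if r were untouched. Inside
  the loop, r and counter 2 hold what is left and what is done; the second loop moves the count
  back.\<close>

lemma run_repeat:
  assumes r: "r \<noteq> 2" and h: "\<And>i. h i r = n" "\<And>i. h i 2 = 0"
    and c: "\<And>i. i < n \<Longrightarrow> run w c ((h i)(r := n - Suc i, 2 := Suc i), out i)
      ((h (Suc i))(r := n - Suc i, 2 := Suc i), out (Suc i)) t"
  shows "run w (repeat r c) (h 0, out 0) (h n, out n) (n * (t + 8) + 2)"
proof -
  define S where "S i = ((h i)(r := n - i, 2 := i), out i)" for i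
  have "run w (While r 1 (Dec r ;; Inc 2 ;; c)) (S 0) (S n) (n * ((1 + (1 + t)) + 2) + 1)"
  proof (rule run_countdown)
    fix i assume i: "i < n"
    let ?h = "(h i)(r := n - Suc i, 2 := i)"
    have 1: "run w (Dec r) (S i) (?h, out i) 1"
      using run_Dec[of w r "fst (S i)" "out i"] r by (simp add: S_def fun_upd_twist)
    have 2: "run w (Inc 2) (?h, out i) (?h(2 := Suc i), out i) 1"
      using run_Inc[of w 2 ?h "out i"] by simp
    have 3: "run w c (?h(2 := Suc i), out i) (S (Suc i)) t"
      using c[OF i] by (simp add: S_def)
    show "run w (Dec r ;; Inc 2 ;; c) (S i) (S (Suc i)) (1 + (1 + t))"
      by (intro run_Seq) (fact 1 2 3)+
  qed (use r in \<open>simp add: S_def\<close>)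
  moreover have "run w (While 2 1 (Dec 2 ;; Inc r)) (S n) (h n, out n) (n * 4 + 1)"
  proof -
    have "(h n)(r := n, 2 := 0) = h n" using h by (auto simp: fun_eq_iff)
    then show ?thesis
      using run_move_counter[OF r, of w "fst (S n)" "out n"] r by (simp add: S_def fun_upd_twist)
  qed
  moreover have "S 0 = (h 0, out 0)" using h by (auto simp: S_def fun_eq_iff)
  ultimately have "run w (repeat r c) (h 0, out 0) (h n, out n) ((n * ((1 + (1 + t)) + 2) + 1) + (n * 4 + 1))"
    unfolding repeat_def by (metis run_Seq)
  then show ?thesis by (rule run_mono) (simp add: algebra_simps)
qed


subsection \<open>Output commands\<close>

definition emits :: "bool list \<Rightarrow> (nat \<Rightarrow> nat) \<Rightarrow> com \<Rightarrow> bool list \<Rightarrow> nat \<Rightarrow> bool" where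
  "emits w h c bs t \<longleftrightarrow> (\<forall>out. run w c (h, out) (h, out @ bs) t)"

lemma emits_mono: "emits w h c bs t \<Longrightarrow> t \<le> t' \<Longrightarrow> emits w h c bs t'"
  unfolding emits_def by (meson run_mono)

lemma emits_Skip: "emits w h Skip [] 0"
  unfolding emits_def run_def using big.Skip by fastforce

lemma emits_Seq: "emits w h c1 bs1 t1 \<Longrightarrow> emits w h c2 bs2 t2 \<Longrightarrow> emits w h (c1 ;; c2) (bs1 @ bs2) (t1 + t2)"
  unfolding emits_def by (metis append_assoc run_Seq)

lemma emits_Out: "emits w h (Out b) [b] 1"
  unfolding emits_def run_def by (blast intro: big.Out)

lemma emits_If:
  assumes "emits w h (if cell_content w r (h r) = a then c1 else c2) bs t"
  shows "emits w h (If_Sym r a c1 c2) bs (t + 2)"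
  unfolding emits_def
proof
  fix out
  obtain t' where t': "t' \<le> t" "big w (if cell_content w r (h r) = a then c1 else c2) (h, out) t' (h, out @ bs)"
    using assms unfolding emits_def run_def by blast
  show "run w (If_Sym r a c1 c2) (h, out) (h, out @ bs) (t + 2)"
  proof (cases "cell_content w r (h r) = a")
    case True
    then have "big w (If_Sym r a c1 c2) (h, out) (1 + t' + 1) (h, out @ bs)"
      using t' by (intro big.If_True) auto
    then show ?thesis using t' unfolding run_def by (intro exI[of _ "1 + t' + 1"]) simp
  next
    case False
    then have "big w (If_Sym r a c1 c2) (h, out) (1 + t') (h, out @ bs)"
      using t' by (intro big.If_False) auto
    then show ?thesis using t' unfolding run_def by (intro exI[of _ "1 + t'"]) simp
  qed
qed

definition sequence :: "com list \<Rightarrow> com" where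
  "sequence cs = foldr Seq cs Skip"

lemma emits_sequence:
  "(\<And>x. x \<in> set xs \<Longrightarrow> emits w h (c x) (bs x) t) \<Longrightarrow>
    emits w h (sequence (map c xs)) (concat (map bs xs)) (length xs * t)"
  by (induction xs) (auto simp: sequence_def intro: emits_Skip emits_Seq)

definition print :: "bool list \<Rightarrow> com" where
  "print bs = sequence (map Out bs)"

lemma emits_print: "emits w h (print bs) bs (length bs)"
  using emits_sequence[of bs w h Out "\<lambda>b. [b]" 1] emits_Out by (simp add: print_def)

text \<open>The body has to work for all counter values, since r and counter 2 change from round to
  round.\<close>

lemma emits_repeat:
  assumes "\<And>h. emits w h c bs t" "r \<noteq> 2" "h 2 = 0"
  shows "emits w h (repeat r c) (concat (replicate (h r) bs)) (h r * (t + 8) + 2)"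
  unfolding emits_def
proof
  fix out
  have "run w (repeat r c) (h, out @ concat (replicate 0 bs)) (h, out @ concat (replicate (h r) bs)) (h r * (t + 8) + 2)"
  proof (rule run_repeat[where h = "\<lambda>_. h" and out = "\<lambda>i. out @ concat (replicate i bs)"])
    fix i
    have "concat (replicate (Suc i) bs) = concat (replicate i bs) @ bs"
      unfolding replicate_Suc replicate_append_same[symmetric] by simp
    then show "run w c (h(r := h r - Suc i, 2 := Suc i), out @ concat (replicate i bs))
        (h(r := h r - Suc i, 2 := Suc i), out @ concat (replicate (Suc i) bs)) t"
      using assms(1) unfolding emits_def by (metis append_assoc)
  qed (use assms in auto)
  then show "run w (repeat r c) (h, out) (h, out @ concat (replicate (h r) bs)) (h r * (t + 8) + 2)" by simp
qed

lemma run_emits: "emits w h c bs t \<Longrightarrow> run w c (h, out) (h, out @ bs) t"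
  by (simp add: emits_def)


subsection \<open>Arithmetic\<close>

text \<open>With the counters in a list, updates become list updates, which simplification
  evaluates.\<close>

definition reg :: "nat list \<Rightarrow> nat \<Rightarrow> nat" where
  "reg xs r = (if r < length xs then xs ! r else 0)"

lemma reg_update [simp]: "r < length xs \<Longrightarrow> (reg xs)(r := v) = reg (xs[r := v])"
  by (auto simp: reg_def fun_eq_iff)

text \<open>Counter 1 holds the base, and counter 7 is scratch.\<close>

definition mult_by_base :: "nat \<Rightarrow> com" where
  "mult_by_base r = While r 1 (Dec r ;; repeat 1 (Inc 7)) ;; While 7 1 (Dec 7 ;; Inc r)"

lemma run_mult:
  assumes r: "r \<notin> {1, 2, 7}" and h: "h 2 = 0" "h 7 = 0"
  shows "run w (mult_by_base r) (h, out) (h(r := h r * h 1), out) (h r * (h 1 * 13 + 5) + 2)"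
proof -
  define S where "S i = (h(r := h r - i, 7 := i * h 1), out)" for i
  have "run w (While r 1 (Dec r ;; repeat 1 (Inc 7))) (S 0) (S (h r)) (h r * ((1 + (h 1 * (1 + 8) + 2)) + 2) + 1)"
  proof (rule run_countdown)
    fix i assume i: "i < h r"
    let ?h = "\<lambda>j. h(r := h r - Suc i, 7 := i * h 1 + j)"
    have 1: "run w (Dec r) (S i) (?h 0, out) 1"
      using run_Dec[of w r "fst (S i)" out] r by (simp add: S_def fun_upd_twist)
    have 2: "run w (repeat 1 (Inc 7)) (?h 0, out) (?h (h 1), out) (h 1 * (1 + 8) + 2)"
    proof (rule run_repeat)
      fix j
      show "run w (Inc 7) ((?h j)(1 := h 1 - Suc j, 2 := Suc j), out)
          ((?h (Suc j))(1 := h 1 - Suc j, 2 := Suc j), out) 1"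
        using run_Inc[of w 7 "(?h j)(1 := h 1 - Suc j, 2 := Suc j)" out] by (simp add: fun_upd_twist)
    qed (use r h in auto)
    have "S (Suc i) = (?h (h 1), out)" by (simp add: S_def add.commute)
    then show "run w (Dec r ;; repeat 1 (Inc 7)) (S i) (S (Suc i)) (1 + (h 1 * (1 + 8) + 2))"
      using run_Seq[OF 1 2] by simp
  qed (use r in \<open>simp add: S_def\<close>)
  moreover have "run w (While 7 1 (Dec 7 ;; Inc r)) (S (h r)) (h(r := h r * h 1), out) (h r * h 1 * 4 + 1)"
  proof -
    have "(h(r := 0, 7 := h r * h 1))(r := h r * h 1, 7 := 0) = h(r := h r * h 1)"
      using h r by (auto simp: fun_eq_iff)
    then show ?thesis using run_move_counter[of r 7 w "fst (S (h r))" out] r by (simp add: S_def)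
  qed
  moreover have "S 0 = (h, out)" using h by (auto simp: S_def fun_eq_iff)
  ultimately have "run w (mult_by_base r) (h, out) (h(r := h r * h 1), out)
      ((h r * ((1 + (h 1 * (1 + 8) + 2)) + 2) + 1) + (h r * h 1 * 4 + 1))"
    unfolding mult_by_base_def by (metis run_Seq)
  then show ?thesis by (rule run_mono) (simp add: algebra_simps)
qed

definition power_of_base :: "nat \<Rightarrow> nat \<Rightarrow> com" where
  "power_of_base e r = Inc r ;; sequence (replicate e (mult_by_base r))"

text \<open>As \<open>0 < m\<close>, no intermediate value exceeds the final one, so the same B
  bounds every multiplication.\<close>

lemma run_power_aux:
  assumes r: "r \<notin> {1, 2, 7}" and h: "h 2 = 0" "h 7 = 0" "h 1 = m" "0 < m" and B: "h r * m ^ e \<le> B"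
  shows "run w (sequence (replicate e (mult_by_base r))) (h, out) (h(r := h r * m ^ e), out) (e * (B * (m * 13 + 5) + 2))"
  using h B
proof (induction e arbitrary: h)
  case 0
  then show ?case using emits_Skip[of w h] by (simp add: emits_def sequence_def)
next
  case (Suc e)
  let ?h = "h(r := h r * m)"
  have "h r * 1 \<le> h r * m ^ Suc e" using Suc.prems by (intro mult_le_mono2) simp
  then have "h r \<le> B" using Suc.prems by linarith
  then have "run w (mult_by_base r) (h, out) (?h, out) (B * (m * 13 + 5) + 2)"
    using run_mult[OF r Suc.prems(1,2), of w out] Suc.prems(3) by (auto elim!: run_mono)
  moreover have "run w (sequence (replicate e (mult_by_base r))) (?h, out) (?h(r := ?h r * m ^ e), out)
      (e * (B * (m * 13 + 5) + 2))"
    using Suc.prems r by (intro Suc.IH) (auto simp: mult.assoc)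
  ultimately have R: "run w (sequence (replicate (Suc e) (mult_by_base r))) (h, out) (?h(r := ?h r * m ^ e), out)
      ((B * (m * 13 + 5) + 2) + e * (B * (m * 13 + 5) + 2))"
    unfolding sequence_def replicate.simps foldr.simps o_def by (rule run_Seq)
  have eq: "?h(r := ?h r * m ^ e) = h(r := h r * m ^ Suc e)" by (auto simp: mult.assoc)
  show ?case using R unfolding eq by (rule run_mono) simp
qed

lemma run_power:
  assumes "r \<notin> {1, 2, 7}" "h 2 = 0" "h 7 = 0" "h 1 = m" "0 < m" "h r = 0"
  shows "run w (power_of_base e r) (h, out) (h(r := m ^ e), out) (1 + e * (m ^ e * (m * 13 + 5) + 2))"
proof -
  have 1: "run w (Inc r) (h, out) (h(r := 1), out) 1"
    using run_Inc[of w r h out] assms by simp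
  have 2: "run w (sequence (replicate e (mult_by_base r))) (h(r := 1), out) (h(r := m ^ e), out)
      (e * (m ^ e * (m * 13 + 5) + 2))"
    using run_power_aux[of r "h(r := 1)" m e "m ^ e" w out] assms by simp
  show ?thesis unfolding power_of_base_def by (rule run_Seq[OF 1 2])
qed


subsection \<open>The instance\<close>

definition slot_bits :: "nat \<Rightarrow> nat set \<Rightarrow> bool list" where
  "slot_bits W S = map (\<lambda>s. s \<in> S) [0..<W]"

abbreviation zeros :: "nat \<Rightarrow> nat \<Rightarrow> bool list" where
  "zeros W n \<equiv> concat (replicate n (replicate W False))"

lemma length_slot_bits [simp]: "length (slot_bits W S) = W"
  by (simp add: slot_bits_def)

text \<open>Counters 3 and 5 together hold the number of cells after the last block, in the first
  row and below alike, because counter 3 has run out when counter 5 starts to fall.\<close>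

definition row_program :: "nat \<Rightarrow> template \<Rightarrow> com" where
  "row_program W S =
     repeat 0 (print (replicate W False)) ;; print (slot_bits W (fst S)) ;;
     print (slot_bits W (fst (snd S))) ;; repeat 4 (print (replicate W False)) ;;
     print (slot_bits W (snd (snd S))) ;;
     repeat 3 (print (replicate W False)) ;; repeat 5 (print (replicate W False))"

definition last_row_program :: "nat \<Rightarrow> template \<Rightarrow> com" where
  "last_row_program W S =
     repeat 0 (print (replicate W False)) ;; print (slot_bits W (fst S)) ;;
     repeat 6 (print (replicate W False))"

text \<open>\<open>gap\<close> stands for \<open>N - 2\<close>, the number of cells strictly between
  \<open>c + 1\<close> and \<open>c + N\<close>, and \<open>rest\<close> for the number of cells
  after \<open>c + N\<close>.\<close>

definition row_bits :: "nat \<Rightarrow> nat \<Rightarrow> nat \<Rightarrow> nat \<Rightarrow> template \<Rightarrow> bool list" where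
  "row_bits W c gap rest S = zeros W c @ slot_bits W (fst S) @ slot_bits W (fst (snd S)) @
     zeros W gap @ slot_bits W (snd (snd S)) @ zeros W rest"

definition last_row_bits :: "nat \<Rightarrow> nat \<Rightarrow> nat \<Rightarrow> template \<Rightarrow> bool list" where
  "last_row_bits W c rest S = zeros W c @ slot_bits W (fst S) @ zeros W rest"

lemma emits_row:
  assumes "h 2 = 0" "h 0 + h 3 + h 4 + h 5 \<le> B"
  shows "emits w h (row_program W S) (row_bits W (h 0) (h 4) (h 3 + h 5) S) (B * (W + 8) + 3 * W + 8)"
proof -
  have z: "emits w h (repeat r (print (replicate W False))) (zeros W (h r)) (h r * (W + 8) + 2)"
    if "r \<noteq> 2" for r
    using emits_repeat[of w "print (replicate W False)" "replicate W False" W r h] that assms(1)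
      emits_print[of w _ "replicate W False"] by simp
  have b: "emits w h (print (slot_bits W A)) (slot_bits W A) W" for A
    using emits_print[of w h "slot_bits W A"] by simp
  have "emits w h (row_program W S)
      (zeros W (h 0) @ slot_bits W (fst S) @ slot_bits W (fst (snd S)) @ zeros W (h 4) @
        slot_bits W (snd (snd S)) @ zeros W (h 3) @ zeros W (h 5))
      ((h 0 * (W + 8) + 2) + (W + (W + ((h 4 * (W + 8) + 2) + (W + ((h 3 * (W + 8) + 2) + (h 5 * (W + 8) + 2)))))))"
    unfolding row_program_def by (intro emits_Seq z b) auto
  then show ?thesis
    unfolding row_bits_def replicate_add concat_append append_assoc
    by (rule emits_mono) (use mult_le_mono1[OF assms(2), of "W + 8"] in \<open>simp add: algebra_simps\<close>)
qed

lemma emits_last_row: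
  assumes "h 2 = 0" "h 0 + h 6 \<le> B"
  shows "emits w h (last_row_program W S) (last_row_bits W (h 0) (h 6) S) (B * (W + 8) + W + 4)"
proof -
  have z: "emits w h (repeat r (print (replicate W False))) (zeros W (h r)) (h r * (W + 8) + 2)"
    if "r \<noteq> 2" for r
    using emits_repeat[of w "print (replicate W False)" "replicate W False" W r h] that assms(1)
      emits_print[of w _ "replicate W False"] by simp
  have b: "emits w h (print (slot_bits W A)) (slot_bits W A) W" for A
    using emits_print[of w h "slot_bits W A"] by simp
  have "emits w h (last_row_program W S)
      (zeros W (h 0) @ slot_bits W (fst S) @ zeros W (h 6))
      ((h 0 * (W + 8) + 2) + (W + (h 6 * (W + 8) + 2)))"
    unfolding last_row_program_def by (intro emits_Seq z b) auto
  then show ?thesis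
    unfolding last_row_bits_def
    by (rule emits_mono) (use mult_le_mono1[OF assms(2), of "W + 8"] in \<open>simp add: algebra_simps\<close>)
qed

text \<open>
  The counters: 0 current cell (the head position on the input), 1 base m, 3 remaining cells of the
  first row (N in total), 4 the gap N - 2, 5 remaining cells below M (M - N in total), 6 remaining
  cells up to M + N, 7 scratch, 8 current cell after the matrix.
\<close>

definition start_program :: "nat \<Rightarrow> com" where
  "start_program e =
     While 0 0 (Inc 0 ;; Inc 1) ;; While 0 1 (Dec 0) ;; Inc 1 ;;
     power_of_base e 3 ;; power_of_base e 4 ;; Dec 4 ;; Dec 4 ;;
     power_of_base (2 * e) 5 ;; power_of_base e 6"

text \<open>The input head passes the marker and all bits up to the first blank, hence
  \<open>length w + 1\<close> rounds; one more increment gives m. The base is at least 2 even for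
  the empty input. The factors 20 and 8 are generous.\<close>

lemma run_start:
  assumes m: "m = length w + 2"
  shows "run w (start_program e) (\<lambda>_. 0, [])
    (reg [0, m, 0, m ^ e, m ^ e - 2, m ^ (2 * e), m ^ e, 0, 0], [])
    (20 * (m + 1) + 8 * (e + 1) * (m ^ e + m ^ (2 * e)) * (m * 13 + 10))"
proof -
  let ?n = "length w + 1"
  let ?P = "\<lambda>e. 1 + e * (m ^ e * (m * 13 + 5) + 2)"
  have init: "(\<lambda>_. 0) = reg [0, 0, 0, 0, 0, 0, 0, 0, 0]"
    by (auto simp: reg_def fun_eq_iff nth_Cons split: nat.split)
  have 1: "run w (While 0 0 (Inc 0 ;; Inc 1)) (reg [0, 0, 0, 0, 0, 0, 0, 0, 0], [])
      (reg [?n, ?n, 0, 0, 0, 0, 0, 0, 0], []) (?n * (2 + 2) + 1)"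
  proof (rule run_While[of ?n w 0 "\<lambda>i. (reg [i, i, 0, 0, 0, 0, 0, 0, 0], [])" 0])
    fix i assume "i < ?n"
    then show "cell_content w 0 (fst (reg [i, i, 0, 0, 0, 0, 0, 0, 0], []) 0) \<noteq> 0"
      by (simp add: reg_def cell_content_def string_tape_def bit_symbol_def)
    have "run w (Inc 0) (reg [i, i, 0, 0, 0, 0, 0, 0, 0], []) (reg [Suc i, i, 0, 0, 0, 0, 0, 0, 0], []) 1"
      using run_Inc[of w 0 "reg [i, i, 0, 0, 0, 0, 0, 0, 0]" "[]"] by (simp add: reg_def[of "_ # _"])
    moreover have "run w (Inc 1) (reg [Suc i, i, 0, 0, 0, 0, 0, 0, 0], [])
        (reg [Suc i, Suc i, 0, 0, 0, 0, 0, 0, 0], []) 1"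
      using run_Inc[of w 1 "reg [Suc i, i, 0, 0, 0, 0, 0, 0, 0]" "[]"] by (simp add: reg_def[of "_ # _"])
    ultimately have "run w (Inc 0 ;; Inc 1) (reg [i, i, 0, 0, 0, 0, 0, 0, 0], [])
        (reg [Suc i, Suc i, 0, 0, 0, 0, 0, 0, 0], []) (1 + 1)" by (rule run_Seq)
    then show "run w (Inc 0 ;; Inc 1) (reg [i, i, 0, 0, 0, 0, 0, 0, 0], [])
        (reg [Suc i, Suc i, 0, 0, 0, 0, 0, 0, 0], []) 2" by (simp add: numeral_2_eq_2)
  qed (simp add: reg_def cell_content_def string_tape_def)
  have 2: "run w (While 0 1 (Dec 0)) (reg [?n, ?n, 0, 0, 0, 0, 0, 0, 0], [])
      (reg [0, ?n, 0, 0, 0, 0, 0, 0, 0], []) (?n * (1 + 2) + 1)"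
  proof -
    have "run w (Dec 0) (reg [?n - i, ?n, 0, 0, 0, 0, 0, 0, 0], [])
        (reg [?n - Suc i, ?n, 0, 0, 0, 0, 0, 0, 0], []) 1" for i
      using run_Dec[of w 0 "reg [?n - i, ?n, 0, 0, 0, 0, 0, 0, 0]" "[]"] by (simp add: reg_def[of "_ # _"])
    then have "run w (While 0 1 (Dec 0)) (reg [?n - 0, ?n, 0, 0, 0, 0, 0, 0, 0], [])
        (reg [?n - ?n, ?n, 0, 0, 0, 0, 0, 0, 0], []) (?n * (1 + 2) + 1)"
      by (intro run_countdown[where S = "\<lambda>i. (reg [?n - i, ?n, 0, 0, 0, 0, 0, 0, 0], [])"])
        (simp_all add: reg_def[of "_ # _"])
    then show ?thesis by simp
  qed
  have 3: "run w (Inc 1) (reg [0, ?n, 0, 0, 0, 0, 0, 0, 0], []) (reg [0, m, 0, 0, 0, 0, 0, 0, 0], []) 1"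
    using run_Inc[of w 1 "reg [0, ?n, 0, 0, 0, 0, 0, 0, 0]" "[]"] m by (simp add: reg_def[of "_ # _"])
  have 4: "run w (power_of_base e 3) (reg [0, m, 0, 0, 0, 0, 0, 0, 0], [])
      (reg [0, m, 0, m ^ e, 0, 0, 0, 0, 0], []) (?P e)"
    using run_power[of 3 "reg [0, m, 0, 0, 0, 0, 0, 0, 0]" m w e "[]"] m by (simp add: reg_def[of "_ # _"])
  have 5: "run w (power_of_base e 4) (reg [0, m, 0, m ^ e, 0, 0, 0, 0, 0], [])
      (reg [0, m, 0, m ^ e, m ^ e, 0, 0, 0, 0], []) (?P e)"
    using run_power[of 4 "reg [0, m, 0, m ^ e, 0, 0, 0, 0, 0]" m w e "[]"] m by (simp add: reg_def[of "_ # _"])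
  have 6: "run w (Dec 4) (reg [0, m, 0, m ^ e, x, 0, 0, 0, 0], []) (reg [0, m, 0, m ^ e, x - 1, 0, 0, 0, 0], []) 1" for x
    using run_Dec[of w 4 "reg [0, m, 0, m ^ e, x, 0, 0, 0, 0]" "[]"] by (simp add: reg_def[of "_ # _"])
  have 7: "run w (power_of_base (2 * e) 5) (reg [0, m, 0, m ^ e, x, 0, 0, 0, 0], [])
      (reg [0, m, 0, m ^ e, x, m ^ (2 * e), 0, 0, 0], []) (?P (2 * e))" for x
    using run_power[of 5 "reg [0, m, 0, m ^ e, x, 0, 0, 0, 0]" m w "2 * e" "[]"] m by (simp add: reg_def[of "_ # _"])
  have 8: "run w (power_of_base e 6) (reg [0, m, 0, m ^ e, x, y, 0, 0, 0], [])
      (reg [0, m, 0, m ^ e, x, y, m ^ e, 0, 0], []) (?P e)" for x y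
    using run_power[of 6 "reg [0, m, 0, m ^ e, x, y, 0, 0, 0]" m w e "[]"] m by (simp add: reg_def[of "_ # _"])
  have "run w (start_program e) (\<lambda>_. 0, [])
      (reg [0, m, 0, m ^ e, m ^ e - 1 - 1, m ^ (2 * e), m ^ e, 0, 0], [])
      ((?n * (2 + 2) + 1) + ((?n * (1 + 2) + 1) + (1 + (?P e + (?P e + (1 + (1 + (?P (2 * e) + ?P e))))))))"
    unfolding start_program_def init
    by (rule run_Seq[OF 1 run_Seq[OF 2 run_Seq[OF 3 run_Seq[OF 4 run_Seq[OF 5
            run_Seq[OF 6 run_Seq[OF 6 run_Seq[OF 7 8]]]]]]]])
  moreover have "(?n * (2 + 2) + 1) + ((?n * (1 + 2) + 1) + (1 + (?P e + (?P e + (1 + (1 + (?P (2 * e) + ?P e))))))) \<le>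
      20 * (m + 1) + 8 * (e + 1) * (m ^ e + m ^ (2 * e)) * (m * 13 + 10)"
  proof -
    have ge: "1 \<le> m ^ e" "1 \<le> m ^ (2 * e)" using m by simp_all
    have P: "?P e \<le> 1 + e * (m ^ e * (m * 13 + 10))"
    proof -
      have "m ^ e * (m * 13 + 5) + 2 \<le> m ^ e * (m * 13 + 10)" using ge by (simp add: algebra_simps)
      then have "e * (m ^ e * (m * 13 + 5) + 2) \<le> e * (m ^ e * (m * 13 + 10))" by (rule mult_le_mono2)
      then show ?thesis by linarith
    qed
    have P2: "?P (2 * e) \<le> 1 + 2 * (e * (m ^ (2 * e) * (m * 13 + 10)))"
    proof -
      have "m ^ (2 * e) * (m * 13 + 5) + 2 \<le> m ^ (2 * e) * (m * 13 + 10)" using ge by (simp add: algebra_simps)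
      then have "2 * e * (m ^ (2 * e) * (m * 13 + 5) + 2) \<le> 2 * e * (m ^ (2 * e) * (m * 13 + 10))"
        by (rule mult_le_mono2)
      then show ?thesis by (simp only: mult.assoc)
    qed
    let ?X = "e * (m ^ e * (m * 13 + 10))" and ?Y = "e * (m ^ (2 * e) * (m * 13 + 10))"
    have "8 * (e + 1) * (m ^ e + m ^ (2 * e)) * (m * 13 + 10) \<ge> 8 * e * (m ^ e + m ^ (2 * e)) * (m * 13 + 10)"
      by (intro mult_le_mono1) simp
    moreover have "8 * e * (m ^ e + m ^ (2 * e)) * (m * 13 + 10) = 8 * ?X + 8 * ?Y" by (simp add: algebra_simps)
    ultimately have XY: "8 * ?X + 8 * ?Y \<le> 8 * (e + 1) * (m ^ e + m ^ (2 * e)) * (m * 13 + 10)" by simp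
    have "(n * (2 + 2) + 1) + ((n * (1 + 2) + 1) + (1 + (p + (p + (1 + (1 + (q + p))))))) \<le> 20 * (m + 1) + z"
      if "m = n + 1" "p \<le> 1 + x" "q \<le> 1 + 2 * y" "8 * x + 8 * y \<le> z" for n p q x y z :: nat
      using that by simp
    from this[OF _ P P2 XY] show ?thesis using m by simp
  qed
  ultimately show ?thesis by (auto elim!: run_mono simp: numeral_2_eq_2)
qed

lemma run_emit_loop:
  assumes "r \<noteq> q" "\<And>i. i \<le> n \<Longrightarrow> h i r = n - i"
    and "\<And>i. i < n \<Longrightarrow> emits w ((h i)(r := n - Suc i)) c (bs i) t"
    and "\<And>i. i < n \<Longrightarrow> (h i)(r := n - Suc i, q := Suc (h i q)) = h (Suc i)"
  shows "run w (While r 1 (Dec r ;; c ;; Inc q)) (h 0, out) (h n, out @ concat (map bs [0..<n])) (n * (t + 4) + 1)"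
proof -
  let ?out = "\<lambda>i. out @ concat (map bs [0..<i])"
  have "run w (While r 1 (Dec r ;; c ;; Inc q)) (h 0, ?out 0) (h n, ?out n) (n * ((1 + (t + 1)) + 2) + 1)"
  proof (rule run_countdown[where S = "\<lambda>i. (h i, ?out i)"])
    fix i assume i: "i < n"
    have 1: "run w (Dec r) (h i, ?out i) ((h i)(r := n - Suc i), ?out i) 1"
      using run_Dec[of w r "h i"] assms(2)[of i] i by simp
    have 2: "run w c ((h i)(r := n - Suc i), ?out i) ((h i)(r := n - Suc i), ?out (Suc i)) t"
      using run_emits[OF assms(3)[OF i], of "?out i"] by simp
    have 3: "run w (Inc q) ((h i)(r := n - Suc i), ?out (Suc i)) (h (Suc i), ?out (Suc i)) 1"
      using run_Inc[of w q "(h i)(r := n - Suc i)" "?out (Suc i)"] assms(1) assms(4)[OF i] by simp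
    show "run w (Dec r ;; c ;; Inc q) (h i, ?out i) (h (Suc i), ?out (Suc i)) (1 + (t + 1))"
      by (rule run_Seq[OF 1 run_Seq[OF 2 3]])
  qed (use assms(2) in simp)
  moreover have "n * ((1 + (t + 1)) + 2) + 1 = n * (t + 4) + 1" by (simp add: algebra_simps)
  moreover have "?out 0 = out" by simp
  ultimately show ?thesis by (simp only:)
qed

text \<open>Counter 0 is the head on the input tape, so the allowed tiles of a cell in the first row
  follow from the scanned symbol; beyond the input it scans blanks.\<close>

definition rows_by_symbol :: "nat \<Rightarrow> (nat \<Rightarrow> template list) \<Rightarrow> com" where
  "rows_by_symbol W T =
     (let rows = \<lambda>a. sequence (map (row_program W) (T a))
      in If_Sym 0 1 (rows 1) (If_Sym 0 2 (rows 2) (If_Sym 0 3 (rows 3) (rows 0))))"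

lemma emits_rows_by_symbol:
  assumes "h 2 = 0" "h 0 + h 3 + h 4 + h 5 \<le> B" "\<And>a. length (T a) = V"
  shows "emits w h (rows_by_symbol W T)
    (concat (map (row_bits W (h 0) (h 4) (h 3 + h 5)) (T (cell_content w 0 (h 0)))))
    (V * (B * (W + 8) + 3 * W + 8) + 6)"
proof -
  let ?a = "cell_content w 0 (h 0)" and ?t = "V * (B * (W + 8) + 3 * W + 8)"
  have rows: "emits w h (sequence (map (row_program W) (T a)))
      (concat (map (row_bits W (h 0) (h 4) (h 3 + h 5)) (T a))) ?t" for a
    using emits_sequence[of "T a" w h "row_program W" "row_bits W (h 0) (h 4) (h 3 + h 5)", OF emits_row]
      assms by simp
  have "?a \<in> {0, 1, 2, 3}" using cell_content_le[of w 0 "h 0"] by auto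
  then have a: "?a = 0 \<or> ?a = 1 \<or> ?a = 2 \<or> ?a = 3" by blast
  let ?bs = "concat (map (row_bits W (h 0) (h 4) (h 3 + h 5)) (T ?a))"
  let ?rows = "\<lambda>a. sequence (map (row_program W) (T a))"
  have 3: "emits w h (If_Sym 0 3 (?rows 3) (?rows 0)) ?bs (?t + 2)" if "?a = 0 \<or> ?a = 3"
    using that rows[of 0] rows[of 3] by (intro emits_If) auto
  have 2: "emits w h (If_Sym 0 2 (?rows 2) (If_Sym 0 3 (?rows 3) (?rows 0))) ?bs (?t + 2 + 2)" if "?a \<noteq> 1"
  proof (rule emits_If, cases "?a = 2")
    case True
    then show "emits w h (if ?a = 2 then ?rows 2 else If_Sym 0 3 (?rows 3) (?rows 0)) ?bs (?t + 2)"
      using emits_mono[OF rows[of 2], of "?t + 2"] by simp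
  qed (use 3 a that in auto)
  have "emits w h (rows_by_symbol W T) ?bs (?t + 2 + 2 + 2)"
    unfolding rows_by_symbol_def Let_def
  proof (rule emits_If, cases "?a = 1")
    case True
    then show "emits w h (if ?a = 1 then ?rows 1 else If_Sym 0 2 (?rows 2) (If_Sym 0 3 (?rows 3) (?rows 0)))
        ?bs (?t + 2 + 2)"
      using emits_mono[OF rows[of 1], of "?t + 2 + 2"] by simp
  qed (use 2 in auto)
  then show ?thesis by (rule emits_mono) simp
qed

text \<open>The matrix takes three loops as its rows have three forms: tiles allowed by input
  symbol, all tiles allowed, no constraints. They leave the number of cells in counter 0. The next
  loop drains it to print \<open>\<tau>\<close>, with counter 8 as the current cell, and the last
  one drains counter 8 to print f.\<close>

definition generator :: "nat \<Rightarrow> nat \<Rightarrow> conflict list \<Rightarrow> (nat \<Rightarrow> nat set) \<Rightarrow> (nat \<Rightarrow> nat) \<Rightarrow> com" where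
  "generator e K Cs al fs =
     (let W = slots K Cs; V = edge_slots K Cs; count = \<lambda>n.
        repeat 3 (print (replicate n True)) ;; repeat 5 (print (replicate n True)) ;;
        repeat 6 (print (replicate n True)) ;; Out False
      in start_program e ;; (count W ;; count V) ;;
        While 3 1 (Dec 3 ;; rows_by_symbol W (\<lambda>a. templates K Cs (al a)) ;; Inc 0) ;;
        While 5 1 (Dec 5 ;; sequence (map (row_program W) (templates K Cs {..<K})) ;; Inc 0) ;;
        While 6 1 (Dec 6 ;; sequence (map (last_row_program W) (templates K Cs {..<K})) ;; Inc 0) ;;
        While 0 1 (Dec 0 ;; sequence (map (\<lambda>s. repeat 8 (print (replicate V True)) ;;
          print (unary s)) [0..<W]) ;; Inc 8) ;;
        While 8 1 (Dec 8 ;; print (concat (map (\<lambda>s. unary (fs s)) [0..<W])) ;; Inc 7))"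

text \<open>The nesting follows the sequence of commands, so that this is the bound composed by
  \<open>run_Seq\<close>.\<close>

definition generator_time :: "nat \<Rightarrow> nat \<Rightarrow> conflict list \<Rightarrow> (nat \<Rightarrow> nat) \<Rightarrow> nat \<Rightarrow> nat" where
  "generator_time e K Cs fs n =
    (let m = n + 2; W = slots K Cs; V = edge_slots K Cs; N = m ^ e; Q = m ^ (2 * e); L = N + Q + N in
     ((20 * (m + 1) + 8 * (e + 1) * (N + Q) * (m * 13 + 10)) +
     (((L * (W + 8) + 7) + (L * (V + 8) + 7)) +
     ((N * (V * (L * (W + 8) + 3 * W + 8) + 6 + 4) + 1) +
     ((Q * (V * (L * (W + 8) + 3 * W + 8) + 4) + 1) +
     ((N * (V * (L * (W + 8) + W + 4) + 4) + 1) +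
     ((L * (W * (L * (V + 8) + W + 3) + 4) + 1) +
      (L * (length (concat (map (\<lambda>s. unary (fs s)) [0..<W])) + 4) + 1))))))))"

lemma concat_replicate_replicate: "concat (replicate n (replicate k x)) = replicate (n * k) x"
  by (induction n) (simp_all add: replicate_add)

lemma run_generator:
  fixes e K Cs al fs w
  defines "m \<equiv> length w + 2" and "W \<equiv> slots K Cs" and "V \<equiv> edge_slots K Cs"
    and "free \<equiv> templates K Cs {..<K}"
  defines "N \<equiv> m ^ e" and "Q \<equiv> m ^ (2 * e)"
  defines "L \<equiv> N + Q + N"
  shows "\<exists>h. run w (generator e K Cs al fs) (\<lambda>_. 0, []) (h,
      unary (L * W) @ unary (L * V) @
      concat (map (\<lambda>i. concat (map (row_bits W i (N - 2) (N - Suc i + Q))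
        (templates K Cs (al (cell_content w 0 i))))) [0..<N]) @
      concat (map (\<lambda>i. concat (map (row_bits W (N + i) (N - 2) (Q - Suc i)) free)) [0..<Q]) @
      concat (map (\<lambda>i. concat (map (last_row_bits W (N + Q + i) (N - Suc i)) free)) [0..<N]) @
      concat (map (\<lambda>i. concat (map (\<lambda>s. unary (i * V + s)) [0..<W])) [0..<L]) @
      concat (map (\<lambda>i. concat (map (\<lambda>s. unary (fs s)) [0..<W])) [0..<L]))
    (generator_time e K Cs fs (length w))"
proof -
  define g where "g = N - 2"
  let ?h0 = "reg [0, m, 0, N, g, Q, N, 0, 0]"
  have start: "run w (start_program e) (\<lambda>_. 0, []) (?h0, [])
      (20 * (m + 1) + 8 * (e + 1) * (N + Q) * (m * 13 + 10))"
    using run_start[of m w e] unfolding N_def Q_def g_def m_def by simp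
  let ?count = "\<lambda>n. repeat 3 (print (replicate n True)) ;; repeat 5 (print (replicate n True)) ;;
    repeat 6 (print (replicate n True)) ;; Out False"
  have count: "emits w ?h0 (?count n) (unary (L * n)) (L * (n + 8) + 7)" for n
  proof -
    have z: "emits w ?h0 (repeat r (print (replicate n True))) (replicate (?h0 r * n) True) (?h0 r * (n + 8) + 2)"
      if "r \<noteq> 2" for r
      using emits_repeat[of w "print (replicate n True)" "replicate n True" n r ?h0] that
        emits_print[of w _ "replicate n True"] by (simp add: concat_replicate_replicate reg_def)
    have "emits w ?h0 (?count n)
        (replicate (?h0 3 * n) True @ replicate (?h0 5 * n) True @ replicate (?h0 6 * n) True @ [False])
        ((?h0 3 * (n + 8) + 2) + ((?h0 5 * (n + 8) + 2) + ((?h0 6 * (n + 8) + 2) + 1)))"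
      by (intro emits_Seq z emits_Out) auto
    moreover have "replicate (?h0 3 * n) True @ replicate (?h0 5 * n) True @ replicate (?h0 6 * n) True @ [False] =
        unary (L * n)"
      by (simp add: unary_def reg_def L_def add_mult_distrib replicate_add)
    ultimately show ?thesis by (auto elim!: emits_mono simp: reg_def L_def add_mult_distrib)
  qed
  have counts: "run w (?count W ;; ?count V) (?h0, []) (?h0, unary (L * W) @ unary (L * V))
      ((L * (W + 8) + 7) + (L * (V + 8) + 7))"
    using run_emits[OF emits_Seq[OF count count], where out = "[]"] by simp
  have loop1: "run w (While 3 1 (Dec 3 ;; rows_by_symbol W (\<lambda>a. templates K Cs (al a)) ;; Inc 0))
      (reg [0, m, 0, N - 0, g, Q, N, 0, 0], out) (reg [N, m, 0, N - N, g, Q, N, 0, 0], out @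
      concat (map (\<lambda>i. concat (map (row_bits W i g (N - Suc i + Q)) (templates K Cs (al (cell_content w 0 i))))) [0..<N]))
      (N * (V * (L * (W + 8) + 3 * W + 8) + 6 + 4) + 1)" for out
  proof (rule run_emit_loop[where h = "\<lambda>i. reg [i, m, 0, N - i, g, Q, N, 0, 0]"])
    fix i assume i: "i < N"
    let ?h = "reg [i, m, 0, N - Suc i, g, Q, N, 0, 0]"
    have "emits w ?h (rows_by_symbol W (\<lambda>a. templates K Cs (al a)))
        (concat (map (row_bits W (?h 0) (?h 4) (?h 3 + ?h 5)) (templates K Cs (al (cell_content w 0 (?h 0))))))
        (V * (L * (W + 8) + 3 * W + 8) + 6)"
      using i by (intro emits_rows_by_symbol) (auto simp: reg_def L_def g_def V_def)
    then show "emits w ((reg [i, m, 0, N - i, g, Q, N, 0, 0])(3 := N - Suc i))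
        (rows_by_symbol W (\<lambda>a. templates K Cs (al a)))
        (concat (map (row_bits W i g (N - Suc i + Q)) (templates K Cs (al (cell_content w 0 i)))))
        (V * (L * (W + 8) + 3 * W + 8) + 6)"
      by (simp add: reg_def[of "_ # _"])
  qed (auto simp: reg_def[of "_ # _"])
  have loop2: "run w (While 5 1 (Dec 5 ;; sequence (map (row_program W) free) ;; Inc 0))
      (reg [N + 0, m, 0, 0, g, Q - 0, N, 0, 0], out) (reg [N + Q, m, 0, 0, g, Q - Q, N, 0, 0], out @
      concat (map (\<lambda>i. concat (map (row_bits W (N + i) g (Q - Suc i)) free)) [0..<Q]))
      (Q * (V * (L * (W + 8) + 3 * W + 8) + 4) + 1)" for out
  proof (rule run_emit_loop[where h = "\<lambda>i. reg [N + i, m, 0, 0, g, Q - i, N, 0, 0]"])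
    fix i assume i: "i < Q"
    let ?h = "reg [N + i, m, 0, 0, g, Q - Suc i, N, 0, 0]"
    have "emits w ?h (sequence (map (row_program W) free))
        (concat (map (row_bits W (?h 0) (?h 4) (?h 3 + ?h 5)) free))
        (length free * (L * (W + 8) + 3 * W + 8))"
      using i by (intro emits_sequence emits_row) (auto simp: reg_def L_def g_def)
    then show "emits w ((reg [N + i, m, 0, 0, g, Q - i, N, 0, 0])(5 := Q - Suc i))
        (sequence (map (row_program W) free)) (concat (map (row_bits W (N + i) g (Q - Suc i)) free))
        (V * (L * (W + 8) + 3 * W + 8))"
      by (simp add: reg_def[of "_ # _"] free_def V_def)
  qed (auto simp: reg_def[of "_ # _"])
  have loop3: "run w (While 6 1 (Dec 6 ;; sequence (map (last_row_program W) free) ;; Inc 0))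
      (reg [N + Q + 0, m, 0, 0, g, 0, N - 0, 0, 0], out) (reg [N + Q + N, m, 0, 0, g, 0, N - N, 0, 0], out @
      concat (map (\<lambda>i. concat (map (last_row_bits W (N + Q + i) (N - Suc i)) free)) [0..<N]))
      (N * (V * (L * (W + 8) + W + 4) + 4) + 1)" for out
  proof (rule run_emit_loop[where h = "\<lambda>i. reg [N + Q + i, m, 0, 0, g, 0, N - i, 0, 0]"])
    fix i assume i: "i < N"
    let ?h = "reg [N + Q + i, m, 0, 0, g, 0, N - Suc i, 0, 0]"
    have "emits w ?h (sequence (map (last_row_program W) free))
        (concat (map (last_row_bits W (?h 0) (?h 6)) free)) (length free * (L * (W + 8) + W + 4))"
      using i by (intro emits_sequence emits_last_row) (auto simp: reg_def L_def)
    then show "emits w ((reg [N + Q + i, m, 0, 0, g, 0, N - i, 0, 0])(6 := N - Suc i))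
        (sequence (map (last_row_program W) free)) (concat (map (last_row_bits W (N + Q + i) (N - Suc i)) free))
        (V * (L * (W + 8) + W + 4))"
      by (simp add: reg_def[of "_ # _"] free_def V_def)
  qed (auto simp: reg_def[of "_ # _"])
  have loop4: "run w (While 0 1 (Dec 0 ;; sequence (map (\<lambda>s. repeat 8 (print (replicate V True)) ;;
        print (unary s)) [0..<W]) ;; Inc 8))
      (reg [L - 0, m, 0, 0, g, 0, 0, 0, 0], out) (reg [L - L, m, 0, 0, g, 0, 0, 0, L], out @
      concat (map (\<lambda>i. concat (map (\<lambda>s. unary (i * V + s)) [0..<W])) [0..<L]))
      (L * (W * (L * (V + 8) + W + 3) + 4) + 1)" for out
  proof (rule run_emit_loop[where h = "\<lambda>i. reg [L - i, m, 0, 0, g, 0, 0, 0, i]"])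
    fix i assume i: "i < L"
    let ?h = "reg [L - Suc i, m, 0, 0, g, 0, 0, 0, i]"
    have "emits w ?h (sequence (map (\<lambda>s. repeat 8 (print (replicate V True)) ;; print (unary s)) [0..<W]))
        (concat (map (\<lambda>s. unary (i * V + s)) [0..<W])) (length [0..<W] * (L * (V + 8) + W + 3))"
    proof (rule emits_sequence)
      fix s assume s: "s \<in> set [0..<W]"
      have "emits w ?h (repeat 8 (print (replicate V True))) (concat (replicate (?h 8) (replicate V True)))
          (?h 8 * (V + 8) + 2)"
        using emits_print[of w _ "replicate V True"] by (intro emits_repeat) (auto simp: reg_def)
      from emits_Seq[OF this emits_print[of w ?h "unary s"]]
      have "emits w ?h (repeat 8 (print (replicate V True)) ;; print (unary s)) (unary (i * V + s))
          ((i * (V + 8) + 2) + (s + 1))"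
        by (simp add: reg_def[of "_ # _"] concat_replicate_replicate unary_def replicate_add)
      moreover have "i * (V + 8) \<le> L * (V + 8)" using i by (intro mult_le_mono1) simp
      then have "(i * (V + 8) + 2) + (s + 1) \<le> L * (V + 8) + W + 3"
        using s unfolding set_upt atLeastLessThan_iff by linarith
      ultimately show "emits w ?h (repeat 8 (print (replicate V True)) ;; print (unary s)) (unary (i * V + s))
          (L * (V + 8) + W + 3)" by (rule emits_mono)
    qed
    then show "emits w ((reg [L - i, m, 0, 0, g, 0, 0, 0, i])(0 := L - Suc i))
        (sequence (map (\<lambda>s. repeat 8 (print (replicate V True)) ;; print (unary s)) [0..<W]))
        (concat (map (\<lambda>s. unary (i * V + s)) [0..<W])) (W * (L * (V + 8) + W + 3))"
      by simp
  qed (auto simp: reg_def[of "_ # _"])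
  let ?F = "concat (map (\<lambda>s. unary (fs s)) [0..<W])"
  have loop5: "run w (While 8 1 (Dec 8 ;; print ?F ;; Inc 7))
      (reg [0, m, 0, 0, g, 0, 0, 0, L - 0], out) (reg [0, m, 0, 0, g, 0, 0, L, L - L], out @
      concat (map (\<lambda>i. ?F) [0..<L])) (L * (length ?F + 4) + 1)" for out
    by (rule run_emit_loop[where h = "\<lambda>i. reg [0, m, 0, 0, g, 0, 0, i, L - i]"])
      (auto simp: reg_def[of "_ # _"] emits_print)
  \<comment> \<open>With the differences \<open>N - 0\<close> and \<open>N - N\<close> evaluated,
    the final state of each loop is the initial state of the next.\<close>
  note l1 = loop1[unfolded diff_zero diff_self_eq_0] and l2 = loop2[unfolded diff_zero diff_self_eq_0 add_0_right]
    and l3 = loop3[unfolded diff_zero diff_self_eq_0 add_0_right, folded L_def]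
    and l4 = loop4[unfolded diff_zero diff_self_eq_0] and l5 = loop5[unfolded diff_zero diff_self_eq_0]
  note runs = run_Seq[OF start run_Seq[OF counts run_Seq[OF l1 run_Seq[OF l2 run_Seq[OF l3 run_Seq[OF l4 l5]]]]]]
  show ?thesis
    unfolding generator_def generator_time_def Let_def m_def[symmetric] W_def[symmetric] V_def[symmetric]
      free_def[symmetric] N_def[symmetric] Q_def[symmetric] L_def[symmetric] g_def[symmetric]
    by (rule exI[of _ "reg [0, m, 0, 0, g, 0, 0, L, 0]"]) (rule runs[unfolded append_assoc])
qed

section \<open>The incidence matrix in blocks\<close>

lemma map_upt_blocks: "map g [0..<L * n] = concat (map (\<lambda>c. map (\<lambda>s. g (c * n + s)) [0..<n]) [0..<L])"
proof (induction L)
  case (Suc L)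
  have "[0..<Suc L * n] = [0..<L * n] @ map (\<lambda>s. s + L * n) [0..<n]"
    unfolding map_add_upt using upt_add_eq_append[of 0 "L * n" n] by (simp add: add.commute)
  then show ?case using Suc by (simp add: add.commute o_def)
qed simp

lemma concat_concat_map: "concat (concat (map f xs)) = concat (map (\<lambda>x. concat (f x)) xs)"
  by (induction xs) auto

lemma concat_map_cong: "(\<And>x. x \<in> set xs \<Longrightarrow> f x = g x) \<Longrightarrow> concat (map f xs) = concat (map g xs)"
  by (metis map_cong)

lemma concat_zero_blocks:
  "(\<And>d. d \<in> set xs \<Longrightarrow> b d = replicate W False) \<Longrightarrow> length xs = n \<Longrightarrow> concat (map b xs) = zeros W n"
  by (induction xs arbitrary: n) auto

lemma upt_split: "i \<le> j \<Longrightarrow> j \<le> k \<Longrightarrow> [i..<k] = [i..<j] @ [j..<k]"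
  by (metis le_add_diff_inverse upt_add_eq_append)

lemma cell_edge_blocks:
  "map (\<lambda>v. v \<in> cell_edge W M N c S) [0..<L * W] = concat (map (\<lambda>d. slot_bits W
     {s. d = c \<and> s \<in> fst S \<or> c < M \<and> (d = c + 1 \<and> s \<in> fst (snd S) \<or> d = c + N \<and> s \<in> snd (snd S))}) [0..<L])"
  unfolding map_upt_blocks slot_bits_def
  by (intro arg_cong[where f = concat] map_cong refl) (auto simp: cell_edge_def)

lemma slot_bits_empty: "slot_bits W {} = replicate W False"
  unfolding slot_bits_def by (simp add: map_replicate_const)

text \<open>By \<open>2 \<le> N\<close> the cells c, \<open>c + 1\<close> and \<open>c + N\<close>
  are distinct and in this order; for \<open>N = 1\<close> two blocks would coincide. After
  \<open>c + N\<close> there remain \<open>M - Suc c\<close> cells.\<close>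

lemma cell_edge_row:
  assumes "c < M" "2 \<le> N"
  shows "map (\<lambda>v. v \<in> cell_edge W M N c S) [0..<(M + N) * W] = row_bits W c (N - 2) (M - Suc c) S"
proof -
  let ?b = "\<lambda>d. slot_bits W
     {s. d = c \<and> s \<in> fst S \<or> c < M \<and> (d = c + 1 \<and> s \<in> fst (snd S) \<or> d = c + N \<and> s \<in> snd (snd S))}"
  have zero: "?b d = replicate W False" if "d \<noteq> c" "d \<noteq> c + 1" "d \<noteq> c + N" for d
    using that by (simp add: slot_bits_empty)
  have "[0..<M + N] = [0..<c] @ [c..<M + N]" using assms by (intro upt_split) auto
  also have "[c..<M + N] = c # Suc c # [c + 2..<M + N]" using assms by (simp add: upt_conv_Cons)
  also have "[c + 2..<M + N] = [c + 2..<c + N] @ [c + N..<M + N]" using assms by (intro upt_split) auto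
  also have "[c + N..<M + N] = (c + N) # [Suc (c + N)..<M + N]" using assms by (simp add: upt_conv_Cons)
  finally have split: "[0..<M + N] = [0..<c] @ c # Suc c # [c + 2..<c + N] @ (c + N) # [Suc (c + N)..<M + N]" .
  have "concat (map ?b [0..<c]) = zeros W c"
    using assms by (intro concat_zero_blocks zero) auto
  moreover have "concat (map ?b [c + 2..<c + N]) = zeros W (N - 2)"
    using assms by (intro concat_zero_blocks zero) auto
  moreover have "concat (map ?b [Suc (c + N)..<M + N]) = zeros W (M - Suc c)"
    using assms by (intro concat_zero_blocks zero) auto
  moreover have "?b c = slot_bits W (fst S)" "?b (Suc c) = slot_bits W (fst (snd S))"
    "?b (c + N) = slot_bits W (snd (snd S))" using assms by simp_all
  ultimately show ?thesis
    unfolding cell_edge_blocks split row_bits_def by (simp only: map_append concat_append list.map concat.simps)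
qed

lemma cell_edge_last_row:
  assumes "M \<le> c" "c < M + N"
  shows "map (\<lambda>v. v \<in> cell_edge W M N c S) [0..<(M + N) * W] = last_row_bits W c (M + N - Suc c) S"
proof -
  let ?b = "\<lambda>d. slot_bits W
     {s. d = c \<and> s \<in> fst S \<or> c < M \<and> (d = c + 1 \<and> s \<in> fst (snd S) \<or> d = c + N \<and> s \<in> snd (snd S))}"
  have zero: "?b d = replicate W False" if "d \<noteq> c" for d
    using that assms by (simp add: slot_bits_empty)
  have "[0..<M + N] = [0..<c] @ [c..<M + N]" using assms by (intro upt_split) auto
  also have "[c..<M + N] = c # [Suc c..<M + N]" using assms by (simp add: upt_conv_Cons)
  finally have split: "[0..<M + N] = [0..<c] @ c # [Suc c..<M + N]" .
  have "concat (map ?b [0..<c]) = zeros W c"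
    using assms by (intro concat_zero_blocks zero) auto
  moreover have "concat (map ?b [Suc c..<M + N]) = zeros W (M + N - Suc c)"
    using assms by (intro concat_zero_blocks zero) auto
  moreover have "?b c = slot_bits W (fst S)" using assms by simp
  ultimately show ?thesis
    unfolding cell_edge_blocks split last_row_bits_def by (simp only: map_append concat_append list.map concat.simps)
qed

lemma upt_shift: "[n..<n + k] = map (\<lambda>i. n + i) [0..<k]"
  using map_add_upt[of n k] by (simp add: add.commute)

lemma encode_tiling_instance:
  fixes K Cs al fs N Q
  defines "W \<equiv> slots K Cs" and "V \<equiv> edge_slots K Cs" and "free \<equiv> templates K Cs {..<K}"
  defines "L \<equiv> N + Q + N"
  assumes N: "2 \<le> N"
  shows "encode (tiling_instance K Cs (\<lambda>c. if c < N then al c else {..<K}) fs (N + Q) N) =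
      unary (L * W) @ unary (L * V) @
      concat (map (\<lambda>i. concat (map (row_bits W i (N - 2) (N - Suc i + Q)) (templates K Cs (al i)))) [0..<N]) @
      concat (map (\<lambda>i. concat (map (row_bits W (N + i) (N - 2) (Q - Suc i)) free)) [0..<Q]) @
      concat (map (\<lambda>i. concat (map (last_row_bits W (N + Q + i) (N - Suc i)) free)) [0..<N]) @
      concat (map (\<lambda>i. concat (map (\<lambda>s. unary (i * V + s)) [0..<W])) [0..<L]) @
      concat (map (\<lambda>i. concat (map (\<lambda>s. unary (fs s)) [0..<W])) [0..<L])"
proof -
  let ?M = "N + Q"
  let ?al = "\<lambda>c. if c < N then al c else {..<K}"
  let ?T = "\<lambda>c. templates K Cs (?al c)"
  let ?rb = "\<lambda>c S. map (\<lambda>v. v \<in> cell_edge W ?M N c S) [0..<L * W]"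
  have lenV: "length (?T c) = V" for c by (simp add: V_def)
  have "concat (map (\<lambda>e. map (\<lambda>v. v \<in> e) [0..<L * W])
      (map (\<lambda>i. cell_edge W ?M N (i div V) (?T (i div V) ! (i mod V))) [0..<L * V])) =
      concat (map (\<lambda>i. ?rb (i div V) (?T (i div V) ! (i mod V))) [0..<L * V])"
    by (simp add: o_def)
  also have "map (\<lambda>i. ?rb (i div V) (?T (i div V) ! (i mod V))) [0..<L * V] =
      concat (map (\<lambda>c. map (?rb c) (?T c)) [0..<L])"
    unfolding map_upt_blocks[of _ L V]
  proof (intro arg_cong[where f = concat] map_cong refl)
    fix c
    have "map (\<lambda>k. ?rb ((c * V + k) div V) (?T ((c * V + k) div V) ! ((c * V + k) mod V))) [0..<V] =
        map (\<lambda>k. ?rb c (?T c ! k)) [0..<V]"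
      by (intro map_cong refl) simp
    also have "\<dots> = map (?rb c) (map ((!) (?T c)) [0..<V])" by (simp only: map_map o_def)
    also have "map ((!) (?T c)) [0..<V] = ?T c" using map_nth[of "?T c"] lenV[of c] by simp
    finally show "map (\<lambda>k. ?rb ((c * V + k) div V) (?T ((c * V + k) div V) ! ((c * V + k) mod V))) [0..<V] =
        map (?rb c) (?T c)" .
  qed
  also have "concat (concat (map (\<lambda>c. map (?rb c) (?T c)) [0..<L])) =
      concat (map (\<lambda>c. concat (map (?rb c) (?T c))) [0..<L])"
    by (simp add: concat_concat_map)
  \<comment> \<open>The three ranges are those of the three loops that print the matrix.\<close>
  also have "[0..<L] = [0..<N] @ map (\<lambda>i. N + i) [0..<Q] @ map (\<lambda>i. N + Q + i) [0..<N]"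
  proof -
    have "[0..<L] = [0..<N] @ [N..<L]" by (intro upt_split) (auto simp: L_def)
    also have "[N..<L] = [N..<N + Q] @ [N + Q..<L]" by (intro upt_split) (auto simp: L_def)
    finally show ?thesis unfolding L_def upt_shift .
  qed
  also have "concat (map (\<lambda>c. concat (map (?rb c) (?T c)))
      ([0..<N] @ map (\<lambda>i. N + i) [0..<Q] @ map (\<lambda>i. N + Q + i) [0..<N])) =
    concat (map (\<lambda>i. concat (map (row_bits W i (N - 2) (N - Suc i + Q)) (templates K Cs (al i)))) [0..<N]) @
      concat (map (\<lambda>i. concat (map (row_bits W (N + i) (N - 2) (Q - Suc i)) free)) [0..<Q]) @
      concat (map (\<lambda>i. concat (map (last_row_bits W (N + Q + i) (N - Suc i)) free)) [0..<N])"
  proof -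
    have 1: "concat (map (?rb i) (?T i)) = concat (map (row_bits W i (N - 2) (N - Suc i + Q)) (templates K Cs (al i)))"
      and 2: "concat (map (?rb (N + Q + i)) (?T (N + Q + i))) = concat (map (last_row_bits W (N + Q + i) (N - Suc i)) free)"
      if i: "i < N" for i
    proof -
      have "?rb i = row_bits W i (N - 2) (N - Suc i + Q)"
        using cell_edge_row[of i ?M N W] i N by (auto simp: L_def fun_eq_iff)
      then show "concat (map (?rb i) (?T i)) = concat (map (row_bits W i (N - 2) (N - Suc i + Q)) (templates K Cs (al i)))"
        using i by simp
      have "?rb (N + Q + i) = last_row_bits W (N + Q + i) (N - Suc i)"
        using cell_edge_last_row[of ?M "N + Q + i" N W] i by (auto simp: L_def fun_eq_iff)
      then show "concat (map (?rb (N + Q + i)) (?T (N + Q + i))) = concat (map (last_row_bits W (N + Q + i) (N - Suc i)) free)"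
        by (simp add: free_def)
    qed
    have 3: "concat (map (?rb (N + i)) (?T (N + i))) = concat (map (row_bits W (N + i) (N - 2) (Q - Suc i)) free)"
      if i: "i < Q" for i
    proof -
      have "?rb (N + i) = row_bits W (N + i) (N - 2) (Q - Suc i)"
        using cell_edge_row[of "N + i" ?M N W] i N by (auto simp: L_def fun_eq_iff)
      then show ?thesis by (simp add: free_def)
    qed
    show ?thesis
      unfolding map_append concat_append map_map o_def
      by (intro arg_cong2[where f = append]; rule concat_map_cong) (rule 1 2 3; simp)+
  qed
  finally have matrix: "concat (map (\<lambda>e. map (\<lambda>v. v \<in> e) [0..<L * W])
      (map (\<lambda>i. cell_edge W ?M N (i div V) (?T (i div V) ! (i mod V))) [0..<L * V])) = \<dots>" .
  have blocks: "concat (map unary (map g [0..<L * W])) =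
      concat (map (\<lambda>i. concat (map (\<lambda>s. unary (g (i * W + s))) [0..<W])) [0..<L])" for g
    unfolding map_upt_blocks map_concat map_map o_def by (simp add: concat_concat_map)
  have tau: "concat (map unary (map (\<lambda>v. v div W * V + v mod W) [0..<L * W])) =
      concat (map (\<lambda>i. concat (map (\<lambda>s. unary (i * V + s)) [0..<W])) [0..<L])"
    unfolding blocks by (intro arg_cong[where f = concat] map_cong refl) simp
  have f: "concat (map unary (map (\<lambda>v. fs (v mod W)) [0..<L * W])) =
      concat (map (\<lambda>i. concat (map (\<lambda>s. unary (fs s)) [0..<W])) [0..<L])"
    unfolding blocks by (intro arg_cong[where f = concat] map_cong refl) simp
  show ?thesis
    unfolding encode_def tiling_instance_def Let_def erhf_instance.simps length_map length_upt diff_zero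
      W_def[symmetric] V_def[symmetric] L_def[symmetric] matrix tau f by simp
qed

section \<open>Polynomial bounds\<close>

text \<open>Closure under sums, products and powers replaces an explicit polynomial for the running
  time.\<close>

definition poly_bounded :: "(nat \<Rightarrow> nat) \<Rightarrow> bool" where
  "poly_bounded f \<longleftrightarrow> (\<exists>p :: nat poly. \<forall>n. f n \<le> poly p n)"

lemma poly_bounded_const: "poly_bounded (\<lambda>_. c)"
  unfolding poly_bounded_def by (intro exI[of _ "[:c:]"]) simp

lemma poly_bounded_id: "poly_bounded (\<lambda>n. n)"
  unfolding poly_bounded_def by (intro exI[of _ "[:0, 1:]"]) simp

lemma poly_bounded_add: "poly_bounded f \<Longrightarrow> poly_bounded g \<Longrightarrow> poly_bounded (\<lambda>n. f n + g n)"
  unfolding poly_bounded_def by (metis add_mono poly_add)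

lemma poly_bounded_mult: "poly_bounded f \<Longrightarrow> poly_bounded g \<Longrightarrow> poly_bounded (\<lambda>n. f n * g n)"
  unfolding poly_bounded_def by (metis mult_le_mono poly_mult)

lemma poly_bounded_power: "poly_bounded f \<Longrightarrow> poly_bounded (\<lambda>n. f n ^ k)"
  by (induction k) (auto intro: poly_bounded_const poly_bounded_mult)

lemma poly_bounded_generator_time: "poly_bounded (generator_time e K Cs fs)"
  unfolding generator_time_def Let_def
  by (intro poly_bounded_add poly_bounded_mult poly_bounded_power poly_bounded_const poly_bounded_id)

text \<open>A base of at least 2 absorbs constants through \<open>a \<le> 2 ^ a\<close>, and a
  further factor \<open>n + 2\<close> pays for the sum of two terms. A single power is easily
  computed by counters.\<close>

lemma poly_le_power: "\<exists>e. \<forall>n. poly p n \<le> (n + 2) ^ e" for p :: "nat poly"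
proof (induction p)
  case 0
  then show ?case by simp
next
  case (pCons a p)
  then obtain e where e: "\<And>n. poly p n \<le> (n + 2) ^ e" by blast
  have "poly (pCons a p) n \<le> (n + 2) ^ (a + e + 2)" for n
  proof -
    have "a \<le> 2 ^ a" by (rule less_imp_le) simp
    also have "\<dots> \<le> (n + 2) ^ a" by (intro power_mono) auto
    also have "\<dots> \<le> (n + 2) ^ (a + e + 1)" by (intro power_increasing) auto
    finally have a: "a \<le> (n + 2) ^ (a + e + 1)" .
    have "n * poly p n \<le> (n + 2) * (n + 2) ^ e" using e[of n] by (intro mult_le_mono) auto
    also have "\<dots> = (n + 2) ^ (e + 1)" by simp
    also have "\<dots> \<le> (n + 2) ^ (a + e + 1)" by (intro power_increasing) auto
    finally have "poly (pCons a p) n \<le> 2 * (n + 2) ^ (a + e + 1)" using a by simp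
    also have "\<dots> \<le> (n + 2) * (n + 2) ^ (a + e + 1)" by (intro mult_le_mono1) simp
    finally show ?thesis by simp
  qed
  then show ?case by blast
qed

section \<open>Hardness\<close>

lemma counters_sequence: "counters (sequence cs) = (\<Union>c\<in>set cs. counters c)"
  by (induction cs) (auto simp: sequence_def)

lemma counters_generator: "counters (generator e K Cs al fs) \<subseteq> {..<9}"
  by (auto simp: generator_def Let_def start_program_def power_of_base_def mult_by_base_def repeat_def
      counters_sequence print_def rows_by_symbol_def row_program_def last_row_program_def)

lemma polytime_generator:
  assumes "0 < e"
  shows "polytime_computable (\<lambda>w. encode (tiling_instance K Cs
    (\<lambda>c. if c < (length w + 2) ^ e then al (cell_content w 0 c) else {..<K}) fs
    ((length w + 2) ^ e + (length w + 2) ^ (2 * e)) ((length w + 2) ^ e)))"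
proof -
  have base: "2 \<le> (length w + 2) ^ e" for w :: "bool list"
    using self_le_power[of "length w + 2" e] assms by simp
  obtain p :: "nat poly" where p: "\<And>n. generator_time e K Cs fs n \<le> poly p n"
    using poly_bounded_generator_time unfolding poly_bounded_def by blast
  show ?thesis
  proof (rule polytime_computableI[of 9 "generator e K Cs al fs" p])
    fix w
    show "\<exists>t h. t \<le> poly p (length w) \<and> big w (generator e K Cs al fs) (\<lambda>_. 0, []) t
        (h, encode (tiling_instance K Cs
          (\<lambda>c. if c < (length w + 2) ^ e then al (cell_content w 0 c) else {..<K}) fs
          ((length w + 2) ^ e + (length w + 2) ^ (2 * e)) ((length w + 2) ^ e)))"
      using run_generator[of w e K Cs al fs] p[of "length w"]
      unfolding encode_tiling_instance[OF base, where al = "\<lambda>c. al (cell_content w 0 c)"] run_def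
      by (meson le_trans)
  qed (use counters_generator in simp_all)
qed

lemma ntm_exists:
  assumes "wf_tm M"
  obtains A where "ntm M A"
proof -
  let ?S = "\<Union>(q, as, q', bs) \<in> trans M. set as \<union> fst ` set bs"
  have "finite ?S" using assms by (auto simp: wf_tm_def)
  then obtain A where A: "?S \<subseteq> {..<A}" by (meson finite_nat_iff_bounded)
  have "ntm M (max 4 A)"
  proof
    fix q as q' bs assume "(q, as, q', bs) \<in> trans M"
    then have "set as \<union> fst ` set bs \<subseteq> ?S" by fast
    then have "set as \<union> fst ` set bs \<subseteq> {..<A}" using A by (rule order_trans)
    moreover have "{..<A} \<subseteq> {..<max 4 A}" by auto
    ultimately have "set as \<union> fst ` set bs \<subseteq> {..<max 4 A}" by (rule order_trans)
    then show "set as \<subseteq> {..<max 4 A} \<and> fst ` set bs \<subseteq> {..<max 4 A}" by (simp only: Un_subset_iff)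
  qed (use assms in auto)
  then show thesis by (rule that)
qed

definition forbidden_pairs :: "nat \<Rightarrow> bool \<Rightarrow> (nat \<Rightarrow> nat \<Rightarrow> bool) \<Rightarrow> conflict list" where
  "forbidden_pairs K up R = [(a, up, b). a \<leftarrow> [0..<K], b \<leftarrow> [0..<K], \<not> R a b]"

lemma set_forbidden_pairs:
  "set (forbidden_pairs K up R) = {(a, up', b). up' = up \<and> a < K \<and> b < K \<and> \<not> R a b}"
  by (auto simp: forbidden_pairs_def)

text \<open>Tiles, conflicts and exponent depend on M and p only, so one program serves all
  inputs.\<close>

lemma poly_reducible_slice:
  fixes fs :: "nat \<Rightarrow> nat \<Rightarrow> nat"
  assumes NP: "wf_tm M" "runs_in_time M p" "\<And>w. w \<in> P \<longleftrightarrow> accepts M w"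
    and fs: "\<And>K s. s < K \<Longrightarrow> fs K s \<le> 1" "\<And>K s. K \<le> s \<Longrightarrow> fs K s = 1 \<or> fs K s = 2"
    and S: "\<And>K s. fs K s \<notin> S"
  shows "poly_reducible P (slice encode ext_RHF (preimage_size S) 0)"
proof -
  obtain A where "ntm M A" using ntm_exists[OF NP(1)] .
  then interpret ntm M A .
  obtain ts where ts: "set ts = tile_set" using finite_list[OF finite_tile_set] by blast
  define K where "K = length ts"
  have K: "0 < K" using ts tile_set_nonempty by (auto simp: K_def)
  \<comment> \<open>Adding \<open>n + 2\<close> to p gives N its three lower bounds at once: above
    the running time, above the input length, and at least 2.\<close>
  obtain e where e: "\<And>n. poly (p + [:2, 1:]) n \<le> (n + 2) ^ e" using poly_le_power by metis
  define Cs where "Cs = forbidden_pairs K False (\<lambda>a b. horizontal (ts ! a) (ts ! b)) @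
    forbidden_pairs K True (\<lambda>a b. vertical (ts ! a) (ts ! b))"
  define al where "al a = {x. x < K \<and> initial a (ts ! x)}" for a
  define N where "N w = (length w + 2) ^ e" for w :: "bool list"
  define Q where "Q w = (length w + 2) ^ (2 * e)" for w :: "bool list"
  define alw where "alw w c = (if c < N w then al (cell_content w 0 c) else {..<K})" for w c
  define J where "J w = tiling_instance K Cs (alw w) (fs K) (N w + Q w) (N w)" for w
  have N: "poly p (length w) < N w" "length w < N w" "2 \<le> N w" for w
    using e[of "length w"] by (simp_all add: N_def)
  have e_pos: "0 < e" using e[of 0] by (cases e) auto
  have setCs: "(a, up, b) \<in> set Cs \<longleftrightarrow>
      a < K \<and> b < K \<and> \<not> (if up then vertical (ts ! a) (ts ! b) else horizontal (ts ! a) (ts ! b))" for a up b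
    by (auto simp: Cs_def set_forbidden_pairs)
  have tiling: "tiling K Cs (alw w) (fs K) (N w)" for w
  proof
    show "0 < K" by fact
    show "0 < N w" using N(3)[of w] by simp
    show "fst (Cs ! j) < K \<and> snd (snd (Cs ! j)) < K" if "j < length Cs" for j
    proof -
      obtain a up b where "Cs ! j = (a, up, b)" by (cases "Cs ! j") auto
      then show ?thesis using setCs[of a up b] nth_mem[OF that] by auto
    qed
    show "alw w c \<subseteq> {..<K}" for c by (auto simp: alw_def al_def)
  qed (use fs in auto)
  have valid: "tiling.valid_tiling Cs (alw w) (N w + Q w) (N w) \<sigma> \<longleftrightarrow>
      (\<forall>c < N w + Q w + N w. \<sigma> c \<in> alw w c) \<and> (\<forall>c < N w + Q w. \<forall>(a, up, b) \<in> set Cs.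
        \<not> (\<sigma> c = a \<and> \<sigma> (c + (if up then N w else 1)) = b))" for w \<sigma>
    unfolding tiling.valid_tiling_def[OF tiling] by (auto simp: all_set_conv_all_nth)
  have accepts: "accepts M w \<longleftrightarrow> (\<exists>\<sigma>. tiling.valid_tiling Cs (alw w) (N w + Q w) (N w) \<sigma>)" for w
  proof
    assume "accepts M w"
    then obtain \<sigma> where \<sigma>: "\<And>c. \<sigma> c \<in> tile_set" "\<And>c. c < N w \<Longrightarrow> initial (fst (string_tape w) c) (\<sigma> c)"
      "\<And>c. horizontal (\<sigma> c) (\<sigma> (c + 1))" "\<And>c. vertical (\<sigma> c) (\<sigma> (c + N w))"
      using tiling_of_run[OF NP(2) N(1,2)] by metis
    have "\<exists>a<K. ts ! a = \<sigma> c" for c using \<sigma>(1)[of c] ts by (metis K_def in_set_conv_nth)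
    then obtain \<rho> where \<rho>: "\<And>c. \<rho> c < K" "\<And>c. ts ! \<rho> c = \<sigma> c" by metis
    have "tiling.valid_tiling Cs (alw w) (N w + Q w) (N w) \<rho>"
      unfolding valid using \<rho> \<sigma> by (auto simp: alw_def al_def cell_content_def setCs split: if_splits)
    then show "\<exists>\<sigma>. tiling.valid_tiling Cs (alw w) (N w + Q w) (N w) \<sigma>" by blast
  next
    assume "\<exists>\<sigma>. tiling.valid_tiling Cs (alw w) (N w + Q w) (N w) \<sigma>"
    then obtain \<sigma> where v: "tiling.valid_tiling Cs (alw w) (N w + Q w) (N w) \<sigma>" by blast
    have \<sigma>: "\<sigma> c \<in> alw w c" if "c < N w + Q w + N w" for c using v that unfolding valid by simp
    have conf: "\<not> (\<sigma> c = a \<and> \<sigma> (c + (if up then N w else 1)) = b)"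
      if "c < N w + Q w" "(a, up, b) \<in> set Cs" for c a up b
    proof -
      from v that(1) have "\<forall>(a, up, b) \<in> set Cs. \<not> (\<sigma> c = a \<and> \<sigma> (c + (if up then N w else 1)) = b)"
        unfolding valid by simp
      from bspec[OF this that(2)] show ?thesis by simp
    qed
    have \<sigma>K: "\<sigma> c < K" if "c < N w + Q w + N w" for c
      using \<sigma>[OF that] by (auto simp: alw_def al_def split: if_splits)
    have "\<exists>d. (step M' ^^ N w) (init_config M w) d"
    proof (rule run_of_tiling[where \<sigma> = "\<lambda>c. ts ! \<sigma> c" and m = "N w + Q w"])
      show "ts ! \<sigma> c \<in> tile_set" if "c < N w + Q w + N w" for c
        using \<sigma>K[OF that] ts by (metis K_def nth_mem)
      \<comment> \<open>The doubled exponent makes \<open>Q w\<close> equal to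
        \<open>N w * N w\<close>.\<close>
      show "N w * N w \<le> N w + Q w" by (simp add: N_def Q_def mult_2 power_add)
      show "length w < N w" by (rule N)
      show "initial (fst (string_tape w) c) (ts ! \<sigma> c)" if "c < N w" for c
        using \<sigma>[of c] that by (simp add: alw_def al_def cell_content_def)
      fix c assume c: "c < N w + Q w"
      then have lt: "c < N w + Q w + N w" "c + 1 < N w + Q w + N w" "c + N w < N w + Q w + N w"
        using N(3)[of w] by auto
      show "horizontal (ts ! \<sigma> c) (ts ! \<sigma> (c + 1))"
        using conf[OF c, of "\<sigma> c" False "\<sigma> (c + 1)"] \<sigma>K lt by (auto simp: setCs)
      show "vertical (ts ! \<sigma> c) (ts ! \<sigma> (c + N w))"
        using conf[OF c, of "\<sigma> c" True "\<sigma> (c + N w)"] \<sigma>K lt by (auto simp: setCs)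
    qed
    then show "accepts M w" using accepts_of_run[OF NP(2) N(1)] by blast
  qed
  \<comment> \<open>f has no value in S, so the parameter is 0 whatever w is.\<close>
  have size: "preimage_size S (J w) = 0" for w
  proof -
    have "{v \<in> vertices (J w). fval (J w) v \<in> S} = {}"
      using S by (auto simp: J_def tiling_instance_def Let_def)
    then show ?thesis by (simp add: preimage_size_def)
  qed
  have "w \<in> P \<longleftrightarrow> encode (J w) \<in> slice encode ext_RHF (preimage_size S) 0" for w
  proof -
    have inst: "J w \<in> erhf_instances" unfolding J_def by (rule tiling.J_instance[OF tiling])
    have "w \<in> P \<longleftrightarrow> J w \<in> ext_RHF"
      unfolding NP(3) accepts J_def tiling.J_in_ext_RHF[OF tiling] ..
    also have "\<dots> \<longleftrightarrow> encode (J w) \<in> slice encode ext_RHF (preimage_size S) 0"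
    proof
      assume "J w \<in> ext_RHF"
      then show "encode (J w) \<in> slice encode ext_RHF (preimage_size S) 0" using size by (auto simp: slice_def)
    next
      assume "encode (J w) \<in> slice encode ext_RHF (preimage_size S) 0"
      \<comment> \<open>The slice is a set of strings; injectivity of \<open>encode\<close> turns
        membership of the string back into a property of the instance.\<close>
      then obtain x where x: "x \<in> ext_RHF" "encode (J w) = encode x" by (auto simp: slice_def)
      then have "x \<in> erhf_instances" by (simp add: ext_RHF_def)
      then show "J w \<in> ext_RHF" using inj_onD[OF inj_on_encode x(2) inst] x by simp
    qed
    finally show ?thesis .
  qed
  moreover have "polytime_computable (\<lambda>w. encode (J w))"
    using polytime_generator[of e K Cs al "fs K"] e_pos unfolding J_def alw_def N_def Q_def by simp
  ultimately show ?thesis unfolding poly_reducible_def by (intro exI[of _ "\<lambda>w. encode (J w)"]) simp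
qed

lemma para_NP_hard_preimage_size:
  fixes fs :: "nat \<Rightarrow> nat \<Rightarrow> nat"
  assumes "\<And>K s. s < K \<Longrightarrow> fs K s \<le> 1" "\<And>K s. K \<le> s \<Longrightarrow> fs K s = 1 \<or> fs K s = 2"
    and "\<And>K s. fs K s \<notin> S"
  shows "para_NP_hard encode ext_RHF (preimage_size S)"
proof -
  have "poly_reducible P (slice encode ext_RHF (preimage_size S) 0)" if "P \<in> NP" for P
  proof -
    from that obtain M p where "wf_tm M" "runs_in_time M p" "\<And>w. w \<in> P \<longleftrightarrow> accepts M w"
      unfolding NP_def by blast
    then show ?thesis by (rule poly_reducible_slice) (fact assms)+
  qed
  then show ?thesis unfolding para_NP_hard_def NP_hard_def by blast
qed

theorem theorem16:
  "para_NP_hard encode ext_RHF (preimage_size {0}) \<and>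
   para_NP_hard encode ext_RHF (preimage_size {1}) \<and>
   para_NP_hard encode ext_RHF (preimage_size {2}) \<and>
   para_NP_hard encode ext_RHF (preimage_size {0, 2})"
proof (intro conjI)
  \<comment> \<open>The constant 1 misses {0}, {2} and {0, 2} at once.\<close>
  have one: "para_NP_hard encode ext_RHF (preimage_size S)" if "1 \<notin> S" for S
    using that by (intro para_NP_hard_preimage_size[of "\<lambda>_ _. 1"]) auto
  show "para_NP_hard encode ext_RHF (preimage_size {0})" by (rule one) simp
  show "para_NP_hard encode ext_RHF (preimage_size {2})" by (rule one) simp
  show "para_NP_hard encode ext_RHF (preimage_size {0, 2})" by (rule one) simp
  \<comment> \<open>Here f has to miss 1, so tiles get 0 and conflict vertices 2.\<close>
  show "para_NP_hard encode ext_RHF (preimage_size {1})"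
    by (rule para_NP_hard_preimage_size[of "\<lambda>K s. if s < K then 0 else 2"]) auto
qed

end
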